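(* Fix an ellipse (the elliptic billiard) $\frac{x^2}{a^2}+\frac{y^2}{b^2}=1$ with $a>b>0$. For each non-isosceles 3-periodic triangle $T$ of this billiard, let $r,R$ be its inradius and circumradius, $\rho=r/R$, let $\lambda$ be the focal length of the Feuerbach hyperbola $F$ of $T$, and let $\lambda'$ be the focal length of the Jerabek hyperbola $J_{exc}$ of the excentral triangle of $T$. Then the ratio $\lambda'/\lambda$ is invariant over all non-isosceles 3-periodics of the billiard (takes the same value for all of them), and it is given by $$\frac{\lambda'}{\lambda}=\sqrt{\frac{2}{\rho}}>2 .$$
   Context: A 3-periodic of the elliptic billiard is a (non-degenerate) triangle inscribed in the ellipse such that at each vertex the normal to the ellipse is the internal angle bisector of the triangle, i.e. a closed billiard trajectory with three elastic bounces; these form a one-parameter family. The excentral triangle of $T$ has as vertices the three excenters of $T$. The Feuerbach hyperbola $F$ of a non-isosceles triangle is the (rectangular) hyperbola through its three vertices, its incenter and its orthocenter; its center is the Feuerbach point $X_{11}$. The Jerabek hyperbola of a non-isosceles triangle is the (rectangular) hyperbola through its three vertices, its circumcenter $X_3$, its orthocenter $X_4$ and its symmedian point $X_6$; $J_{exc}$ is the Jerabek hyperbola of the excentral triangle, i.e. it passes through the three excenters of $T$, and through the incenter $X_1$ and the Mittenpunkt $X_9$ of $T$ (the orthocenter and symmedian point of the excentral triangle). The focal length of a hyperbola is the distance between its two foci. *)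

theory Defs
  imports "HOL-Analysis.Analysis"
begin

type_synonym point = "real \<times> real"

section \<open>Triangles\<close>

definition triangle :: "point \<Rightarrow> point \<Rightarrow> point \<Rightarrow> bool" where
  "triangle A B C \<longleftrightarrow> \<not> collinear {A, B, C}"

definition scalene :: "point \<Rightarrow> point \<Rightarrow> point \<Rightarrow> bool" where
  "scalene A B C \<longleftrightarrow>
     dist A B \<noteq> dist B C \<and> dist B C \<noteq> dist C A \<and> dist C A \<noteq> dist A B"

definition line_along :: "point \<Rightarrow> point \<Rightarrow> point set" where
  "line_along P v = range (\<lambda>t. P + t *\<^sub>R v)"

text \<open>The bisectors at the vertex \<open>A\<close> of the triangle \<open>A B C\<close>. Here \<open>sgn v\<close> is the unit vector
  \<open>v /\<^sub>R norm v\<close>; the sum of the unit vectors along the two sides bisects the angle \<open>B A C\<close>,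
  their difference bisects the adjacent angle.\<close>

definition internal_bisector :: "point \<Rightarrow> point \<Rightarrow> point \<Rightarrow> point set" where
  "internal_bisector A B C = line_along A (sgn (B - A) + sgn (C - A))"

definition external_bisector :: "point \<Rightarrow> point \<Rightarrow> point \<Rightarrow> point set" where
  "external_bisector A B C = line_along A (sgn (B - A) - sgn (C - A))"

definition incenter :: "point \<Rightarrow> point \<Rightarrow> point \<Rightarrow> point" where
  "incenter A B C = (THE P. P \<in> internal_bisector A B C \<and>
     P \<in> internal_bisector B C A \<and> P \<in> internal_bisector C A B)"

text \<open>The excenter opposite to the first vertex.\<close>

definition excenter :: "point \<Rightarrow> point \<Rightarrow> point \<Rightarrow> point" where
  "excenter A B C = (THE P. P \<in> internal_bisector A B C \<and>
     P \<in> external_bisector B C A \<and> P \<in> external_bisector C A B)"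

definition circumcenter :: "point \<Rightarrow> point \<Rightarrow> point \<Rightarrow> point" where
  "circumcenter A B C = (THE P. dist P A = dist P B \<and> dist P B = dist P C)"

definition orthocenter :: "point \<Rightarrow> point \<Rightarrow> point \<Rightarrow> point" where
  "orthocenter A B C = (THE P. (P - A) \<bullet> (B - C) = 0 \<and>
     (P - B) \<bullet> (C - A) = 0 \<and> (P - C) \<bullet> (A - B) = 0)"

definition reflect_along :: "point \<Rightarrow> point \<Rightarrow> point \<Rightarrow> point" where
  "reflect_along A v P = A + (2 * ((P - A) \<bullet> sgn v)) *\<^sub>R sgn v - (P - A)"

text \<open>The symmedian through \<open>A\<close> is the mirror image of the median through \<open>A\<close> in the
  internal bisector at \<open>A\<close>.\<close>

definition symmedian :: "point \<Rightarrow> point \<Rightarrow> point \<Rightarrow> point set" where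
  "symmedian A B C =
     reflect_along A (sgn (B - A) + sgn (C - A)) ` (affine hull {A, midpoint B C})"

definition symmedian_point :: "point \<Rightarrow> point \<Rightarrow> point \<Rightarrow> point" where
  "symmedian_point A B C = (THE P. P \<in> symmedian A B C \<and>
     P \<in> symmedian B C A \<and> P \<in> symmedian C A B)"

text \<open>The incenter has the same distance from all three side lines.\<close>

definition inradius :: "point \<Rightarrow> point \<Rightarrow> point \<Rightarrow> real" where
  "inradius A B C = infdist (incenter A B C) (affine hull {B, C})"

definition circumradius :: "point \<Rightarrow> point \<Rightarrow> point \<Rightarrow> real" where
  "circumradius A B C = dist (circumcenter A B C) A"

section \<open>Hyperbolas\<close>

definition hyperbola_with_foci :: "point \<Rightarrow> point \<Rightarrow> real \<Rightarrow> point set \<Rightarrow> bool" where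
  "hyperbola_with_foci F G d H \<longleftrightarrow>
     0 < d \<and> d < dist F G \<and> H = {P. \<bar>dist P F - dist P G\<bar> = d}"

text \<open>A hyperbola with semi-axes \<open>p\<close> and \<open>q\<close> has \<open>d = 2 * p\<close> and \<open>dist F G = 2 * sqrt (p\<^sup>2 + q\<^sup>2)\<close>.
  The asymptotes are perpendicular iff \<open>p = q\<close>, i.e. iff the eccentricity \<open>dist F G / d\<close> is
  \<open>sqrt 2\<close>.\<close>

definition rectangular_hyperbola :: "point set \<Rightarrow> bool" where
  "rectangular_hyperbola H \<longleftrightarrow>
     (\<exists>F G d. hyperbola_with_foci F G d H \<and> dist F G = sqrt 2 * d)"

definition focal_length :: "point set \<Rightarrow> real" where
  "focal_length H = (THE l. \<exists>F G d. hyperbola_with_foci F G d H \<and> l = dist F G)"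

text \<open>Rectangularity is needed for uniqueness when the triangle has a right angle: then the
  orthocenter is one of the vertices.\<close>

definition Feuerbach_hyperbola :: "point \<Rightarrow> point \<Rightarrow> point \<Rightarrow> point set" where
  "Feuerbach_hyperbola A B C = (THE H. rectangular_hyperbola H \<and>
     {A, B, C, incenter A B C, orthocenter A B C} \<subseteq> H)"

definition Jerabek_hyperbola :: "point \<Rightarrow> point \<Rightarrow> point \<Rightarrow> point set" where
  "Jerabek_hyperbola A B C = (THE H. rectangular_hyperbola H \<and>
     {A, B, C, circumcenter A B C, orthocenter A B C, symmedian_point A B C} \<subseteq> H)"

definition excentral_Jerabek_hyperbola :: "point \<Rightarrow> point \<Rightarrow> point \<Rightarrow> point set" where
  "excentral_Jerabek_hyperbola A B C =
     Jerabek_hyperbola (excenter A B C) (excenter B C A) (excenter C A B)"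

section \<open>The elliptic billiard\<close>

definition ellipse :: "real \<Rightarrow> real \<Rightarrow> point set" where
  "ellipse a b = {(x, y). x\<^sup>2 / a\<^sup>2 + y\<^sup>2 / b\<^sup>2 = 1}"

text \<open>The normal at \<open>P\<close> has the direction of the gradient of \<open>x\<^sup>2 / a\<^sup>2 + y\<^sup>2 / b\<^sup>2\<close>.\<close>

definition ellipse_normal :: "real \<Rightarrow> real \<Rightarrow> point \<Rightarrow> point set" where
  "ellipse_normal a b P = line_along P (fst P / a\<^sup>2, snd P / b\<^sup>2)"

definition billiard_3_periodic :: "real \<Rightarrow> real \<Rightarrow> point \<Rightarrow> point \<Rightarrow> point \<Rightarrow> bool" where
  "billiard_3_periodic a b A B C \<longleftrightarrow>
     triangle A B C \<and> {A, B, C} \<subseteq> ellipse a b \<and>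
     ellipse_normal a b A = internal_bisector A B C \<and>
     ellipse_normal a b B = internal_bisector B C A \<and>
     ellipse_normal a b C = internal_bisector C A B"

end

theory Submission
  imports Defs
begin

text \<open>After a similarity the incenter is \<open>0\<close> and the inradius is \<open>1\<close>; the triangle is then given by the
  tangent lengths \<open>y\<close> and \<open>z\<close> at two vertices, and the incenter, the excenters and all other centers involved
  are rational in \<open>y\<close> and \<open>z\<close>. The two hyperbolas pass through \<open>0\<close> and turn out to have the same
  quadratic part, so the ratio of the focal lengths follows from the linear parts.
  For the invariance, the normals of the billiard ellipse all pass through the incenter; this determines
  the ellipse up to scale from \<open>y\<close> and \<open>z\<close> and makes its axis ratio a strictly monotone
  function of \<open>\<rho>\<close>.\<close>

section \<open>Rectangular hyperbolas\<close>

text \<open>Centers, hyperbolas and focal lengths are definite descriptions, the last one of a bare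
  point set. Each calls for existence and uniqueness; in particular the set of points must determine
  the distance of the foci, and passing to the normalized triangle needs unique witnesses.

  A rectangular conic through \<open>0\<close> with trace-free symmetric matrix \<open>M\<close> and
  linear part \<open>g\<close> has squared focal length \<open>2 * |g . M g| / N^(3/2)\<close>,
  where \<open>M^2\<close> is \<open>N\<close> times the identity. With equal quadratic parts only
  the two numbers \<open>g . M g\<close> matter. Their quotient is \<open>W / (2 * m)\<close>, twice
  the circumradius for inradius \<open>1\<close>, hence the \<open>2 / \<rho>\<close> under the
  root. For the Feuerbach hyperbola this number vanishes exactly when two tangent lengths agree:
  this is where \<open>scalene\<close> enters.

  The similarity leaves the position of the ellipse arbitrary, so its equation is never written in
  normalized coordinates. Its gradient is a self-adjoint linear map, and trace and determinant
  survive a change of basis: \<open>trace^2 / det\<close> depends only on \<open>a / b\<close> on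
  one side and only on \<open>W / m = 4 / \<rho>\<close> on the other.\<close>

definition rect_conic :: "real \<Rightarrow> real \<Rightarrow> real \<Rightarrow> real \<Rightarrow> real \<Rightarrow> point set" where
  "rect_conic \<alpha> \<beta> \<gamma> \<delta> \<epsilon> =
     {(x, y). \<alpha> * (x\<^sup>2 - y\<^sup>2) + 2 * \<beta> * x * y + \<gamma> * x + \<delta> * y + \<epsilon> = 0}"

section \<open>The focal definition of a hyperbola as a quadratic equation\<close>

lemma dist_prod_sq: "(dist P Q)\<^sup>2 = (fst P - fst Q)\<^sup>2 + (snd P - snd Q)\<^sup>2" for P Q :: point
  by (simp add: dist_Pair_Pair dist_prod_def dist_real_def)

text \<open>Squaring twice gives \<open>((s - t)\<^sup>2 - d\<^sup>2) * ((s + t)\<^sup>2 -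
  d\<^sup>2)\<close>. The second factor is spurious and is excluded by \<open>d < s + t\<close>, so
  no solutions are gained.\<close>

lemma abs_diff_eq_iff_poly:
  fixes s t d :: real
  assumes "0 \<le> s" "0 \<le> t" "0 < d" "d < s + t"
  shows "\<bar>s - t\<bar> = d \<longleftrightarrow> (s\<^sup>2 - t\<^sup>2)\<^sup>2 - 2 * d\<^sup>2 * (s\<^sup>2 + t\<^sup>2) + d ^ 4 = 0"
proof -
  have "(s\<^sup>2 - t\<^sup>2)\<^sup>2 - 2 * d\<^sup>2 * (s\<^sup>2 + t\<^sup>2) + d ^ 4 = ((s - t)\<^sup>2 - d\<^sup>2) * ((s + t)\<^sup>2 - d\<^sup>2)"
    by algebra
  moreover have "d\<^sup>2 < (s + t)\<^sup>2" using assms by (intro power_strict_mono) auto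
  ultimately have "(s\<^sup>2 - t\<^sup>2)\<^sup>2 - 2 * d\<^sup>2 * (s\<^sup>2 + t\<^sup>2) + d ^ 4 = 0 \<longleftrightarrow> (s - t)\<^sup>2 = d\<^sup>2"
    by auto
  also have "\<dots> \<longleftrightarrow> \<bar>s - t\<bar> = d"
    using assms(3) by (smt (verit) power2_eq_iff)
  finally show ?thesis by simp
qed

text \<open>Center \<open>(m1, m2)\<close> and half focal vector \<open>(w1, w2)\<close> keep the
  equation symmetric. The triangle inequality with the two foci supplies \<open>d < s + t\<close> at
  every point.\<close>

lemma hyperbola_with_foci_poly:
  assumes "hyperbola_with_foci (m1 - w1, m2 - w2) (m1 + w1, m2 + w2) d H"
  shows "(x, y) \<in> H \<longleftrightarrow>
    4 * ((x - m1) * w1 + (y - m2) * w2)\<^sup>2 - d\<^sup>2 * ((x - m1)\<^sup>2 + (y - m2)\<^sup>2)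
      = d\<^sup>2 * (w1\<^sup>2 + w2\<^sup>2) - d ^ 4 / 4"
proof -
  let ?P = "(x, y)" and ?F = "(m1 - w1, m2 - w2)" and ?G = "(m1 + w1, m2 + w2)"
  have "0 < d" and d: "d < dist ?F ?G" and H: "H = {P. \<bar>dist P ?F - dist P ?G\<bar> = d}"
    using assms by (auto simp: hyperbola_with_foci_def)
  have "d < dist ?P ?F + dist ?P ?G"
    using d dist_triangle3[of ?F ?G ?P] by linarith
  then have "?P \<in> H \<longleftrightarrow> ((dist ?P ?F)\<^sup>2 - (dist ?P ?G)\<^sup>2)\<^sup>2
      - 2 * d\<^sup>2 * ((dist ?P ?F)\<^sup>2 + (dist ?P ?G)\<^sup>2) + d ^ 4 = 0"
    unfolding H mem_Collect_eq using \<open>0 < d\<close> by (intro abs_diff_eq_iff_poly) auto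
  also have "\<dots> \<longleftrightarrow> 4 * (4 * ((x - m1) * w1 + (y - m2) * w2)\<^sup>2
      - d\<^sup>2 * ((x - m1)\<^sup>2 + (y - m2)\<^sup>2) - d\<^sup>2 * (w1\<^sup>2 + w2\<^sup>2) + d ^ 4 / 4) = 0"
    unfolding dist_prod_sq fst_conv snd_conv
    by (rule arg_cong[where f = "\<lambda>t. t = 0"]) (simp add: power2_eq_square algebra_simps)
  finally show ?thesis by (smt (verit))
qed

lemma foci_midpoint_form:
  fixes F G :: point
  obtains m1 m2 w1 w2 where "F = (m1 - w1, m2 - w2)" "G = (m1 + w1, m2 + w2)"
proof
  show "F = ((fst F + fst G) / 2 - (fst G - fst F) / 2, (snd F + snd G) / 2 - (snd G - snd F) / 2)"
    by (cases F) (simp add: field_simps)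
  show "G = ((fst F + fst G) / 2 + (fst G - fst F) / 2, (snd F + snd G) / 2 + (snd G - snd F) / 2)"
    by (cases G) (simp add: field_simps)
qed

lemma dist_foci_sq: "(dist (m1 - w1, m2 - w2) (m1 + w1, m2 + w2))\<^sup>2 = 4 * (w1\<^sup>2 + w2\<^sup>2)"
  for m1 :: real and m2 :: real
  unfolding dist_prod_sq by (simp add: power2_eq_square algebra_simps)

text \<open>For \<open>d\<^sup>2 = 2 * (w1\<^sup>2 + w2\<^sup>2)\<close> the quadratic part becomes
  trace-free, which is what \<open>rect_conic\<close> encodes. As a complex number,
  \<open>\<alpha> + i * \<beta>\<close> is twice the square of \<open>w1 + i * w2\<close>, hence
  nonzero.\<close>

lemma rectangular_hyperbola_conic:
  assumes "rectangular_hyperbola H"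
  obtains \<alpha> \<beta> \<gamma> \<delta> \<epsilon> where "\<alpha> \<noteq> 0 \<or> \<beta> \<noteq> 0" "H = rect_conic \<alpha> \<beta> \<gamma> \<delta> \<epsilon>"
proof -
  obtain F G d where FG: "hyperbola_with_foci F G d H" "dist F G = sqrt 2 * d"
    using assms by (auto simp: rectangular_hyperbola_def)
  obtain m1 m2 w1 w2 where F: "F = (m1 - w1, m2 - w2)" and G: "G = (m1 + w1, m2 + w2)"
    by (rule foci_midpoint_form)
  have "0 < d" using FG by (simp add: hyperbola_with_foci_def)
  have "(dist F G)\<^sup>2 = 2 * d\<^sup>2" using FG(2) by (simp add: power_mult_distrib)
  then have d: "d\<^sup>2 = 2 * (w1\<^sup>2 + w2\<^sup>2)" by (simp add: F G dist_foci_sq)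
  have d4: "d ^ 4 = (2 * (w1\<^sup>2 + w2\<^sup>2))\<^sup>2" using d by algebra
  define \<alpha> where "\<alpha> = 2 * (w1\<^sup>2 - w2\<^sup>2)"
  define \<beta> where "\<beta> = 4 * w1 * w2"
  define \<gamma> where "\<gamma> = - 2 * \<alpha> * m1 - 2 * \<beta> * m2"
  define \<delta> where "\<delta> = 2 * \<alpha> * m2 - 2 * \<beta> * m1"
  define \<epsilon> where "\<epsilon> = \<alpha> * (m1\<^sup>2 - m2\<^sup>2) + 2 * \<beta> * m1 * m2 - (w1\<^sup>2 + w2\<^sup>2)\<^sup>2"
  have "w1\<^sup>2 + w2\<^sup>2 > 0" using d \<open>0 < d\<close> by (smt (verit) zero_less_power)
  moreover have "\<alpha>\<^sup>2 + \<beta>\<^sup>2 = 4 * (w1\<^sup>2 + w2\<^sup>2)\<^sup>2" unfolding \<alpha>_def \<beta>_def by algebra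
  ultimately have "\<alpha> \<noteq> 0 \<or> \<beta> \<noteq> 0" by (metis add.right_neutral less_irrefl mult_eq_0_iff power_eq_0_iff zero_neq_numeral zero_power2)
  moreover have "H = rect_conic \<alpha> \<beta> \<gamma> \<delta> \<epsilon>"
  proof (rule set_eqI)
    fix P :: point
    obtain x y where P: "P = (x, y)" by (cases P)
    show "P \<in> H \<longleftrightarrow> P \<in> rect_conic \<alpha> \<beta> \<gamma> \<delta> \<epsilon>"
    proof -
      have "4 * ((x - m1) * w1 + (y - m2) * w2)\<^sup>2
          - 2 * (w1\<^sup>2 + w2\<^sup>2) * ((x - m1)\<^sup>2 + (y - m2)\<^sup>2)
          - (2 * (w1\<^sup>2 + w2\<^sup>2) * (w1\<^sup>2 + w2\<^sup>2) - (2 * (w1\<^sup>2 + w2\<^sup>2))\<^sup>2 / 4)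
        = \<alpha> * (x\<^sup>2 - y\<^sup>2) + 2 * \<beta> * x * y + \<gamma> * x + \<delta> * y + \<epsilon>"
        by (simp add: \<alpha>_def \<beta>_def \<gamma>_def \<delta>_def \<epsilon>_def power2_eq_square algebra_simps)
      then show ?thesis
        unfolding P hyperbola_with_foci_poly[OF FG(1)[unfolded F G]] d d4 rect_conic_def
          mem_Collect_eq prod.case by linarith
    qed
  qed
  ultimately show ?thesis using that by blast
qed

text \<open>The number \<open>k\<close> is the quadratic part evaluated at the linear part
  \<open>(\<gamma>, \<delta>)\<close>. Up to a constant factor it is the determinant of the conic,
  so \<open>k \<noteq> 0\<close> rules out a degenerate pair of lines.\<close>

lemma rect_conic_foci:
  fixes \<alpha> \<beta> \<gamma> \<delta> :: real
  defines "N \<equiv> \<alpha>\<^sup>2 + \<beta>\<^sup>2" and "k \<equiv> \<alpha> * (\<gamma>\<^sup>2 - \<delta>\<^sup>2) + 2 * \<beta> * \<gamma> * \<delta>"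
  assumes "k \<noteq> 0"
  obtains F G d where "hyperbola_with_foci F G d (rect_conic \<alpha> \<beta> \<gamma> \<delta> 0)"
    "dist F G = sqrt 2 * d" "dist F G = sqrt (2 * \<bar>k\<bar> / (N * sqrt N))"
proof -
  have N: "N > 0" using \<open>k \<noteq> 0\<close> unfolding N_def k_def
    by (metis add.right_neutral mult_zero_left mult_zero_right sum_power2_gt_zero_iff)
  define K where "K = k / (4 * N)"
  have "K \<noteq> 0" using N assms by (simp add: K_def)
  \<comment> \<open>The center is the zero of the gradient. The equation takes the value
    \<open>- K\<close> there, so in centered coordinates the quadratic form equals
    \<open>K\<close>.\<close>
  define m1 where "m1 = - (\<alpha> * \<gamma> + \<beta> * \<delta>) / (2 * N)"
  define m2 where "m2 = (\<alpha> * \<delta> - \<beta> * \<gamma>) / (2 * N)"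
  have m1N: "2 * N * m1 = - (\<alpha> * \<gamma> + \<beta> * \<delta>)" and m2N: "2 * N * m2 = \<alpha> * \<delta> - \<beta> * \<gamma>"
    using N by (simp_all add: m1_def m2_def)
  \<comment> \<open>The quadratic part of a rectangular hyperbola is given by the real and imaginary
    part of the square of \<open>w1 + i * w2\<close>, so a complex square root recovers the foci.
    The sign of \<open>K\<close> decides in which pair of sectors the branches lie.\<close>
  define \<omega> where "\<omega> = csqrt (Complex (2 * K * \<alpha> / N) (2 * K * \<beta> / N))"
  define w1 where "w1 = Re \<omega>"
  define w2 where "w2 = Im \<omega>"
  have "\<omega>\<^sup>2 = Complex (2 * K * \<alpha> / N) (2 * K * \<beta> / N)" by (simp add: \<omega>_def)
  then have w: "w1\<^sup>2 - w2\<^sup>2 = 2 * K * \<alpha> / N" "2 * w1 * w2 = 2 * K * \<beta> / N"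
    unfolding w1_def w2_def by (auto simp: complex_eq_iff power2_eq_square algebra_simps)
  define W where "W = w1\<^sup>2 + w2\<^sup>2"
  have "W\<^sup>2 = (w1\<^sup>2 - w2\<^sup>2)\<^sup>2 + (2 * w1 * w2)\<^sup>2" unfolding W_def by algebra
  also have "\<dots> = 4 * K\<^sup>2 * N / N\<^sup>2" unfolding w N_def
    by (simp add: power_divide power_mult_distrib add_divide_distrib[symmetric] algebra_simps)
  finally have W2: "W\<^sup>2 = 4 * K\<^sup>2 / N" using N by (simp add: power2_eq_square)
  have "W \<ge> 0" by (simp add: W_def)
  then have W: "W = 2 * \<bar>K\<bar> / sqrt N"
    using W2 real_sqrt_unique[of W "4 * K\<^sup>2 / N"] by (simp add: real_sqrt_divide real_sqrt_mult)
  then have "W > 0" using N \<open>K \<noteq> 0\<close> by simp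
  define F where "F = (m1 - w1, m2 - w2)"
  define G where "G = (m1 + w1, m2 + w2)"
  define d where "d = sqrt (2 * W)"
  have FG: "dist F G = sqrt (4 * W)"
    using dist_foci_sq[of m1 w1 m2 w2] by (metis F_def G_def W_def real_sqrt_unique zero_le_dist)
  have "d > 0" using \<open>W > 0\<close> by (simp add: d_def)
  have "d < dist F G" unfolding FG d_def using \<open>W > 0\<close> by (intro real_sqrt_less_mono) simp
  then have hyp: "hyperbola_with_foci F G d {P. \<bar>dist P F - dist P G\<bar> = d}"
    using \<open>d > 0\<close> by (simp add: hyperbola_with_foci_def)
  have d2: "d\<^sup>2 = 2 * W" using \<open>W > 0\<close> by (simp add: d_def)
  have d4: "d ^ 4 = (2 * W)\<^sup>2" using d2 by algebra
  have "{P. \<bar>dist P F - dist P G\<bar> = d} = rect_conic \<alpha> \<beta> \<gamma> \<delta> 0"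
  proof (rule set_eqI)
    fix P :: point
    obtain x y where P: "P = (x, y)" by (cases P)
    have "P \<in> {P. \<bar>dist P F - dist P G\<bar> = d} \<longleftrightarrow>
      4 * ((x - m1) * w1 + (y - m2) * w2)\<^sup>2 - 2 * W * ((x - m1)\<^sup>2 + (y - m2)\<^sup>2) = W\<^sup>2"
      unfolding P hyperbola_with_foci_poly[OF hyp[unfolded F_def G_def], folded F_def G_def] d2 d4
        W_def[symmetric] by (simp add: power2_eq_square)
    also have "4 * ((x - m1) * w1 + (y - m2) * w2)\<^sup>2 - 2 * W * ((x - m1)\<^sup>2 + (y - m2)\<^sup>2) =
       2 * ((w1\<^sup>2 - w2\<^sup>2) * ((x - m1)\<^sup>2 - (y - m2)\<^sup>2) + 2 * (2 * w1 * w2) * (x - m1) * (y - m2))"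
      unfolding W_def by algebra
    also have "\<dots> = 4 * K / N * (\<alpha> * ((x - m1)\<^sup>2 - (y - m2)\<^sup>2) + 2 * \<beta> * (x - m1) * (y - m2))"
      unfolding w using N by (simp add: field_simps)
    also have "\<dots> = W\<^sup>2 \<longleftrightarrow> \<alpha> * ((x - m1)\<^sup>2 - (y - m2)\<^sup>2) + 2 * \<beta> * (x - m1) * (y - m2) = K"
      unfolding W2 using N \<open>K \<noteq> 0\<close> by (simp add: power2_eq_square)
    also have "\<dots> \<longleftrightarrow> 4 * N * (\<alpha> * ((x - m1)\<^sup>2 - (y - m2)\<^sup>2) + 2 * \<beta> * (x - m1) * (y - m2)) - k = 0"
      using N by (simp add: K_def field_simps)
    also have "4 * N * (\<alpha> * ((x - m1)\<^sup>2 - (y - m2)\<^sup>2) + 2 * \<beta> * (x - m1) * (y - m2)) - k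
      = 4 * N * (\<alpha> * (x\<^sup>2 - y\<^sup>2) + 2 * \<beta> * x * y + \<gamma> * x + \<delta> * y)"
    proof -
      \<comment> \<open>After multiplication by \<open>N\<close> the center enters only through
        \<open>2 * N * m1\<close> and \<open>2 * N * m2\<close>, which are polynomials in the
        coefficients.\<close>
      have "N * (4 * N * (\<alpha> * ((x - m1)\<^sup>2 - (y - m2)\<^sup>2) + 2 * \<beta> * (x - m1) * (y - m2)) - k)
        = \<alpha> * ((2 * N * x - 2 * N * m1)\<^sup>2 - (2 * N * y - 2 * N * m2)\<^sup>2)
          + 2 * \<beta> * (2 * N * x - 2 * N * m1) * (2 * N * y - 2 * N * m2) - N * k"
        by algebra
      also have "\<dots> = N * (4 * N * (\<alpha> * (x\<^sup>2 - y\<^sup>2) + 2 * \<beta> * x * y + \<gamma> * x + \<delta> * y))"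
        unfolding m1N m2N unfolding k_def N_def by algebra
      finally show ?thesis using N by simp
    qed
    finally show "P \<in> {P. \<bar>dist P F - dist P G\<bar> = d} \<longleftrightarrow> P \<in> rect_conic \<alpha> \<beta> \<gamma> \<delta> 0"
      using N by (simp add: P rect_conic_def)
  qed
  moreover have "dist F G = sqrt 2 * d" unfolding FG d_def by (simp add: real_sqrt_mult[symmetric])
  moreover have "dist F G = sqrt (2 * \<bar>k\<bar> / (N * sqrt N))"
    unfolding FG W K_def using N by (simp add: abs_mult)
  ultimately show ?thesis using that hyp by metis
qed

section \<open>The point set determines the distance of the foci\<close>

lemma conic_through_unit_hyperbola:
  fixes A B C D E G :: real
  assumes "\<forall>s t. s\<^sup>2 - t\<^sup>2 = 1 \<longrightarrow> A * s\<^sup>2 + B * s * t + C * t\<^sup>2 + D * s + E * t + G = 0"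
  shows "B = 0" "C = - A" "D = 0" "E = 0" "G = - A"
  \<comment> \<open>Six rational points of the unit hyperbola provide enough linear equations for
    the coefficients.\<close>
  using assms[rule_format, of 1 0] assms[rule_format, of "-1" 0]
    assms[rule_format, of "5/4" "3/4"] assms[rule_format, of "-5/4" "3/4"]
    assms[rule_format, of "5/4" "-3/4"] assms[rule_format, of "-5/4" "-3/4"]
  by (simp_all add: power2_eq_square)

text \<open>The description in \<open>focal_length\<close> ranges over all pairs of foci, so the
  second pair must be allowed any eccentricity. The rectangular pair parametrizes \<open>H\<close>
  by \<open>s\<^sup>2 - t\<^sup>2 = 1\<close>; inserting this into the other equation and comparing
  coefficients shows in turn that the other hyperbola is rectangular, concentric and of the same
  size.\<close>

lemma foci_dist_unique:
  assumes hyp: "hyperbola_with_foci F G d H" and rect: "dist F G = sqrt 2 * d"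
    and hyp': "hyperbola_with_foci F' G' d' H"
  shows "dist F' G' = dist F G"
proof -
  obtain m1 m2 w1 w2 where F: "F = (m1 - w1, m2 - w2)" and G: "G = (m1 + w1, m2 + w2)"
    by (rule foci_midpoint_form)
  obtain n1 n2 v1 v2 where F': "F' = (n1 - v1, n2 - v2)" and G': "G' = (n1 + v1, n2 + v2)"
    by (rule foci_midpoint_form)
  \<comment> \<open>\<open>(p, q)\<close> leads from the center to a vertex of the
    hyperbola.\<close>
  define p where "p = w1 / sqrt 2"
  define q where "q = w2 / sqrt 2"
  have w: "w1 = sqrt 2 * p" "w2 = sqrt 2 * q" by (simp_all add: p_def q_def)
  have sq2: "(sqrt 2)\<^sup>2 = (2 :: real)" by simp
  define M where "M = p\<^sup>2 + q\<^sup>2"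
  define V where "V = v1\<^sup>2 + v2\<^sup>2"
  have "0 < d" using hyp by (simp add: hyperbola_with_foci_def)
  have "0 < d'" "d' < dist F' G'" using hyp' by (simp_all add: hyperbola_with_foci_def)
  have wM: "w1\<^sup>2 + w2\<^sup>2 = 2 * M" unfolding w M_def by (simp add: power_mult_distrib)
  have FG: "(dist F G)\<^sup>2 = 8 * M" by (simp add: F G dist_foci_sq wM)
  have FG': "(dist F' G')\<^sup>2 = 4 * V" by (simp add: F' G' dist_foci_sq V_def)
  have d2: "d\<^sup>2 = 4 * M" using FG rect by (simp add: power_mult_distrib)
  have d4: "d ^ 4 = (4 * M)\<^sup>2" using d2 by algebra
  have "M > 0" using d2 \<open>0 < d\<close> by (smt (verit) zero_less_power)
  define E where "E = d'\<^sup>2"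
  have "E > 0" using \<open>0 < d'\<close> by (simp add: E_def)
  have "d'\<^sup>2 < (dist F' G')\<^sup>2" using \<open>0 < d'\<close> \<open>d' < dist F' G'\<close> by (intro power_strict_mono) auto
  then have "V > 0" using FG' \<open>E > 0\<close> E_def by linarith
  have E4: "d' ^ 4 = E\<^sup>2" unfolding E_def by algebra
  \<comment> \<open>\<open>(k1, k2)\<close> is the displacement of the centers. \<open>P\<close>,
    \<open>Q\<close> and \<open>a\<close>, \<open>b\<close> are the components of the second half
    focal vector and of the displacement along the axes of the first hyperbola, up to the factor
    \<open>sqrt M\<close>.\<close>
  define k1 where "k1 = m1 - n1"
  define k2 where "k2 = m2 - n2"
  define U where "U = k1 * v1 + k2 * v2"
  define P where "P = p * v1 + q * v2"
  define Q where "Q = p * v2 - q * v1"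
  define a where "a = k1 * p + k2 * q"
  define b where "b = k2 * p - k1 * q"
  have conic: "\<forall>s t. s\<^sup>2 - t\<^sup>2 = 1 \<longrightarrow> (4 * P\<^sup>2 - E * M) * s\<^sup>2 + (8 * P * Q) * s * t + (4 * Q\<^sup>2 - E * M) * t\<^sup>2
      + (8 * U * P - 2 * E * a) * s + (8 * U * Q - 2 * E * b) * t
      + (4 * U\<^sup>2 - E * (k1\<^sup>2 + k2\<^sup>2) - E * V + E\<^sup>2 / 4) = 0"
  proof (intro allI impI)
    fix s t :: real assume that: "s\<^sup>2 - t\<^sup>2 = 1"
    let ?x = "m1 + (s * p - t * q)" and ?y = "m2 + (s * q + t * p)"
    have "4 * ((?x - m1) * w1 + (?y - m2) * w2)\<^sup>2 - d\<^sup>2 * ((?x - m1)\<^sup>2 + (?y - m2)\<^sup>2)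
      = 4 * (sqrt 2)\<^sup>2 * (s * M)\<^sup>2 - 4 * M * ((s\<^sup>2 + t\<^sup>2) * M)"
      unfolding d2 w M_def by algebra
    also have "\<dots> = 4 * M\<^sup>2 * (s\<^sup>2 - t\<^sup>2)" unfolding sq2 by algebra
    also have "\<dots> = d\<^sup>2 * (w1\<^sup>2 + w2\<^sup>2) - d ^ 4 / 4"
      unfolding that wM d2 d4 by (simp add: power2_eq_square)
    finally have "(?x, ?y) \<in> H"
      unfolding hyperbola_with_foci_poly[OF hyp[unfolded F G]] .
    then have "4 * ((?x - n1) * v1 + (?y - n2) * v2)\<^sup>2 - E * ((?x - n1)\<^sup>2 + (?y - n2)\<^sup>2)
      = E * V - E\<^sup>2 / 4"
      unfolding hyperbola_with_foci_poly[OF hyp'[unfolded F' G']] E_def[symmetric] E4 V_def .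
    moreover have "4 * ((?x - n1) * v1 + (?y - n2) * v2)\<^sup>2 - E * ((?x - n1)\<^sup>2 + (?y - n2)\<^sup>2)
      = (4 * P\<^sup>2 - E * M) * s\<^sup>2 + (8 * P * Q) * s * t + (4 * Q\<^sup>2 - E * M) * t\<^sup>2
      + (8 * U * P - 2 * E * a) * s + (8 * U * Q - 2 * E * b) * t
      + (4 * U\<^sup>2 - E * (k1\<^sup>2 + k2\<^sup>2))"
      unfolding k1_def k2_def U_def P_def Q_def a_def b_def M_def by algebra
    ultimately show "(4 * P\<^sup>2 - E * M) * s\<^sup>2 + (8 * P * Q) * s * t + (4 * Q\<^sup>2 - E * M) * t\<^sup>2
      + (8 * U * P - 2 * E * a) * s + (8 * U * Q - 2 * E * b) * t
      + (4 * U\<^sup>2 - E * (k1\<^sup>2 + k2\<^sup>2) - E * V + E\<^sup>2 / 4) = 0" by linarith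
  qed
  note c = conic_through_unit_hyperbola[OF conic]
  have PQ: "P = 0 \<or> Q = 0" using c(1) by simp
  have PQ2: "P\<^sup>2 + Q\<^sup>2 = M * V" unfolding P_def Q_def M_def V_def by algebra
  then have "M * (2 * V - E) = 0" using c(2) by algebra
  \<comment> \<open>This is eccentricity \<open>sqrt 2\<close> for the second pair.\<close>
  then have E: "E = 2 * V" using \<open>M > 0\<close> by simp
  have Va: "V * a = 2 * U * P" and Vb: "V * b = 2 * U * Q" using c(3,4) E by (auto simp: mult_ac)
  have MU: "M * U = a * P + b * Q"
    unfolding M_def U_def a_def b_def P_def Q_def by algebra
  have "V * (M * U) = 2 * U * (P\<^sup>2 + Q\<^sup>2)" unfolding MU using Va Vb by algebra
  then have "U = 0" unfolding PQ2 using \<open>M > 0\<close> \<open>V > 0\<close> by simp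
  then have "a = 0" "b = 0" using Va Vb \<open>V > 0\<close> by auto
  moreover have "M * (k1\<^sup>2 + k2\<^sup>2) = a\<^sup>2 + b\<^sup>2" unfolding M_def a_def b_def by algebra
  ultimately have k: "k1\<^sup>2 + k2\<^sup>2 = 0" using \<open>M > 0\<close> by simp
  have G: "V\<^sup>2 = 4 * P\<^sup>2 - 2 * V * M"
    using c(5) unfolding k \<open>U = 0\<close> E by (simp add: power2_eq_square)
  have "P \<noteq> 0"
  proof
    assume "P = 0"
    then have "V\<^sup>2 = - (2 * V * M)" using G by simp
    then show False using \<open>M > 0\<close> \<open>V > 0\<close> by (smt (verit) mult_pos_pos zero_less_power)
  qed
  then have "P\<^sup>2 = M * V" using PQ PQ2 by simp
  then have "V * V = V * (2 * M)" using G by (simp add: power2_eq_square)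
  then have "(dist F' G')\<^sup>2 = (dist F G)\<^sup>2" using \<open>V > 0\<close> FG FG' by simp
  then show ?thesis by simp
qed

lemma focal_length_eq:
  assumes "hyperbola_with_foci F G d H" "dist F G = sqrt 2 * d"
  shows "focal_length H = dist F G"
  unfolding focal_length_def
  using assms foci_dist_unique by (intro the_equality) blast+

lemma rect_conic_hyperbola:
  fixes \<alpha> \<beta> \<gamma> \<delta> :: real
  defines "N \<equiv> \<alpha>\<^sup>2 + \<beta>\<^sup>2" and "k \<equiv> \<alpha> * (\<gamma>\<^sup>2 - \<delta>\<^sup>2) + 2 * \<beta> * \<gamma> * \<delta>"
  assumes "k \<noteq> 0"
  shows "rectangular_hyperbola (rect_conic \<alpha> \<beta> \<gamma> \<delta> 0)"
    and "focal_length (rect_conic \<alpha> \<beta> \<gamma> \<delta> 0) = sqrt (2 * \<bar>k\<bar> / (N * sqrt N))"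
proof -
  obtain F G d where FG: "hyperbola_with_foci F G d (rect_conic \<alpha> \<beta> \<gamma> \<delta> 0)"
    "dist F G = sqrt 2 * d" "dist F G = sqrt (2 * \<bar>k\<bar> / (N * sqrt N))"
    using rect_conic_foci[of \<alpha> \<gamma> \<delta> \<beta>] \<open>k \<noteq> 0\<close> unfolding N_def k_def by blast
  show "rectangular_hyperbola (rect_conic \<alpha> \<beta> \<gamma> \<delta> 0)"
    unfolding rectangular_hyperbola_def using FG by blast
  show "focal_length (rect_conic \<alpha> \<beta> \<gamma> \<delta> 0) = sqrt (2 * \<bar>k\<bar> / (N * sqrt N))"
    using focal_length_eq[OF FG(1,2)] FG(3) by simp
qed

section \<open>Similarities\<close>

lemma line_along_scaleR: "c \<noteq> 0 \<Longrightarrow> line_along P (c *\<^sub>R v) = line_along P v"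
proof (intro subset_antisym subsetI)
  fix X assume "X \<in> line_along P v" "c \<noteq> 0"
  then obtain t where "X = P + (t / c) *\<^sub>R (c *\<^sub>R v)" by (auto simp: line_along_def)
  then show "X \<in> line_along P (c *\<^sub>R v)" unfolding line_along_def by blast
qed (auto simp: line_along_def)

locale similarity =
  fixes \<phi> :: "point \<Rightarrow> point" and Z :: point and L :: "point \<Rightarrow> point" and r :: real
  assumes linear: "linear L" and norm_L: "norm (L v) = r * norm v" and r_pos: "0 < r"
    and \<phi>_eq: "\<phi> p = Z + L p"
begin

lemma inner_L: "L u \<bullet> L v = r\<^sup>2 * (u \<bullet> v)"
  unfolding dot_norm linear_add[OF linear, symmetric] norm_L
  by (simp add: power_mult_distrib field_simps)

lemma diff_\<phi>: "\<phi> p - \<phi> q = L (p - q)"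
  by (simp add: \<phi>_eq linear_diff[OF linear])

lemma \<phi>_add: "\<phi> (p + v) = \<phi> p + L v"
  by (simp add: \<phi>_eq linear_add[OF linear])

lemma dist_\<phi>: "dist (\<phi> p) (\<phi> q) = r * dist p q"
  by (simp add: dist_norm diff_\<phi> norm_L)

lemma inj_L: "inj L"
  using norm_L r_pos by (intro linear_injective_0[THEN iffD2] linear) (metis mult_eq_0_iff norm_eq_zero less_irrefl)

lemma bij_\<phi>: "bij \<phi>"
proof -
  have "surj L" by (rule linear_inj_imp_surj[OF linear inj_L])
  have "\<phi> (inv L (p - Z)) = p" for p
    by (simp add: \<phi>_eq surj_f_inv_f[OF \<open>surj L\<close>])
  then have "surj \<phi>" by (rule surjI)
  moreover have "inj \<phi>" using inj_L by (auto simp: inj_on_def \<phi>_eq)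
  ultimately show ?thesis by (simp add: bij_def)
qed

lemma \<phi>_inject [simp]: "\<phi> p = \<phi> q \<longleftrightarrow> p = q"
  using bij_\<phi> by (simp add: bij_is_inj inj_eq)

lemma \<phi>_cases: obtains p where "P = \<phi> p"
  using bij_pointE[OF bij_\<phi>] that by metis

lemma \<phi>_mem_image [simp]: "\<phi> p \<in> \<phi> ` S \<longleftrightarrow> p \<in> S"
  by auto

lemma sgn_L: "sgn (L v) = (1 / r) *\<^sub>R L (sgn v)"
  by (simp add: sgn_div_norm norm_L linear_cmul[OF linear] divide_inverse)

text \<open>Unit vectors acquire the factor \<open>1 / r\<close> under \<open>L\<close>, so
  directions arrive as multiples of \<open>L v\<close>; a line does not see the multiple.\<close>

lemma line_along_image:
  assumes "c \<noteq> 0" shows "line_along (\<phi> P) (c *\<^sub>R L v) = \<phi> ` line_along P v"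
  unfolding line_along_scaleR[OF assms]
  by (simp add: line_along_def image_image \<phi>_add linear_cmul[OF linear])

lemma sgn_diff_\<phi>: "sgn (\<phi> p - \<phi> q) = (1 / r) *\<^sub>R L (sgn (p - q))"
  by (simp add: diff_\<phi> sgn_L)

lemma internal_bisector_image:
  "internal_bisector (\<phi> A) (\<phi> B) (\<phi> C) = \<phi> ` internal_bisector A B C"
  using r_pos line_along_image[of "1 / r" A "sgn (B - A) + sgn (C - A)"]
  by (simp add: internal_bisector_def sgn_diff_\<phi> linear_add[OF linear] scaleR_add_right)

lemma external_bisector_image:
  "external_bisector (\<phi> A) (\<phi> B) (\<phi> C) = \<phi> ` external_bisector A B C"
  using r_pos line_along_image[of "1 / r" A "sgn (B - A) - sgn (C - A)"]
  by (simp add: external_bisector_def sgn_diff_\<phi> linear_diff[OF linear] scaleR_diff_right)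

lemma affine_hull_image: "affine hull (\<phi> ` S) = \<phi> ` (affine hull S)"
proof -
  have "\<phi> ` T = (+) Z ` L ` T" for T by (auto simp: \<phi>_eq image_image)
  then show ?thesis
    using affine_hull_linear_image[OF linear[unfolded linear_conv_bounded_linear]]
    by (simp add: affine_hull_translation)
qed

lemma midpoint_\<phi>: "midpoint (\<phi> p) (\<phi> q) = \<phi> (midpoint p q)"
proof -
  have "L (midpoint p q) = midpoint (L p) (L q)"
    by (simp add: midpoint_def linear_cmul[OF linear] linear_add[OF linear])
  then show ?thesis by (simp add: \<phi>_eq midpoint_def algebra_simps flip: scaleR_2)
qed

lemma reflect_along_image:
  assumes "c > 0"
  shows "reflect_along (\<phi> A) (c *\<^sub>R L v) (\<phi> P) = \<phi> (reflect_along A v P)"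
proof -
  have s: "sgn (c *\<^sub>R L v) = (1 / r) *\<^sub>R L (sgn v)" using assms by (simp add: sgn_scaleR sgn_L)
  \<comment> \<open>The new bracketing shows a point plus a single vector, the form to which
    \<open>\<phi>_add\<close> applies.\<close>
  have "reflect_along A v P = A + ((2 * ((P - A) \<bullet> sgn v)) *\<^sub>R sgn v - (P - A))"
    by (simp add: reflect_along_def)
  then have "\<phi> (reflect_along A v P)
      = \<phi> A + ((2 * ((P - A) \<bullet> sgn v)) *\<^sub>R L (sgn v) - L (P - A))"
    by (simp only: \<phi>_add linear_diff[OF linear] linear_cmul[OF linear])
  also have "\<dots> = reflect_along (\<phi> A) (c *\<^sub>R L v) (\<phi> P)"
    unfolding reflect_along_def s diff_\<phi>
    using r_pos by (simp add: inner_L power2_eq_square algebra_simps)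
  finally show ?thesis by simp
qed

lemma symmedian_image: "symmedian (\<phi> A) (\<phi> B) (\<phi> C) = \<phi> ` symmedian A B C"
proof -
  have v: "sgn (\<phi> B - \<phi> A) + sgn (\<phi> C - \<phi> A) = (1 / r) *\<^sub>R L (sgn (B - A) + sgn (C - A))"
    by (simp add: sgn_diff_\<phi> linear_add[OF linear] scaleR_add_right)
  have "affine hull {\<phi> A, midpoint (\<phi> B) (\<phi> C)} = \<phi> ` (affine hull {A, midpoint B C})"
    using affine_hull_image[of "{A, midpoint B C}"] by (simp add: midpoint_\<phi>)
  then show ?thesis
    unfolding symmedian_def v using r_pos by (simp add: image_image reflect_along_image)
qed

text \<open>\<open>THE\<close> can be moved through the bijection \<open>\<phi>\<close> only if the
  description has exactly one witness; otherwise its value is unspecified and need not follow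
  \<open>\<phi>\<close>. This explains the premises of the center lemmas below.\<close>

lemma the_image:
  assumes "\<And>p. Q' (\<phi> p) \<longleftrightarrow> Q p" "\<exists>!p. Q p"
  shows "(THE P. Q' P) = \<phi> (THE p. Q p)"
proof (rule the_equality)
  show "Q' (\<phi> (THE p. Q p))" using assms by (simp add: theI')
  fix P assume "Q' P"
  moreover obtain p where P: "P = \<phi> p" by (rule \<phi>_cases)
  ultimately have "Q p" using assms(1) by simp
  then show "P = \<phi> (THE p. Q p)" using the1_equality[OF assms(2)] P by simp
qed

lemma the_image_set:
  assumes "\<And>H. Q' (\<phi> ` H) \<longleftrightarrow> Q H" "\<exists>!H. Q H"
  shows "(THE P. Q' P) = \<phi> ` (THE p. Q p)"
proof (rule the_equality)
  show "Q' (\<phi> ` (THE p. Q p))" using assms by (simp add: theI')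
  fix P assume "Q' P"
  moreover have P: "P = \<phi> ` (\<phi> -` P)" using bij_\<phi> by (simp add: bij_def surj_image_vimage_eq)
  ultimately have "Q (\<phi> -` P)" using assms(1) by metis
  then show "P = \<phi> ` (THE p. Q p)" using the1_equality[OF assms(2)] P by simp
qed

lemma incenter_image:
  assumes "\<exists>!P. P \<in> internal_bisector A B C \<and> P \<in> internal_bisector B C A \<and> P \<in> internal_bisector C A B"
  shows "incenter (\<phi> A) (\<phi> B) (\<phi> C) = \<phi> (incenter A B C)"
  unfolding incenter_def by (rule the_image[OF _ assms]) (simp add: internal_bisector_image)

lemma excenter_image:
  assumes "\<exists>!P. P \<in> internal_bisector A B C \<and> P \<in> external_bisector B C A \<and> P \<in> external_bisector C A B"
  shows "excenter (\<phi> A) (\<phi> B) (\<phi> C) = \<phi> (excenter A B C)"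
  unfolding excenter_def
  by (rule the_image[OF _ assms]) (simp add: internal_bisector_image external_bisector_image)

lemma circumcenter_image:
  assumes "\<exists>!P. dist P A = dist P B \<and> dist P B = dist P C"
  shows "circumcenter (\<phi> A) (\<phi> B) (\<phi> C) = \<phi> (circumcenter A B C)"
  unfolding circumcenter_def by (rule the_image[OF _ assms]) (use r_pos in \<open>simp add: dist_\<phi>\<close>)

lemma orthocenter_image:
  assumes "\<exists>!P. (P - A) \<bullet> (B - C) = 0 \<and> (P - B) \<bullet> (C - A) = 0 \<and> (P - C) \<bullet> (A - B) = 0"
  shows "orthocenter (\<phi> A) (\<phi> B) (\<phi> C) = \<phi> (orthocenter A B C)"
  unfolding orthocenter_def
  by (rule the_image[OF _ assms]) (use r_pos in \<open>simp add: diff_\<phi> inner_L\<close>)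

lemma symmedian_point_image:
  assumes "\<exists>!P. P \<in> symmedian A B C \<and> P \<in> symmedian B C A \<and> P \<in> symmedian C A B"
  shows "symmedian_point (\<phi> A) (\<phi> B) (\<phi> C) = \<phi> (symmedian_point A B C)"
  unfolding symmedian_point_def by (rule the_image[OF _ assms]) (simp add: symmedian_image)

lemma infdist_image: "S \<noteq> {} \<Longrightarrow> infdist (\<phi> p) (\<phi> ` S) = r * infdist p S"
proof -
  assume "S \<noteq> {}"
  have "(INF x\<in>S. r * dist p x) = r * (INF x\<in>S. dist p x)"
  proof (rule antisym)
    have bdd: "bdd_below ((\<lambda>x. r * dist p x) ` S)" "bdd_below ((\<lambda>x. dist p x) ` S)"
      using r_pos by (auto intro!: bdd_belowI[of _ 0])
    show "r * (INF x\<in>S. dist p x) \<le> (INF x\<in>S. r * dist p x)"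
      using r_pos \<open>S \<noteq> {}\<close> bdd by (intro cINF_greatest) (auto intro!: cINF_lower mult_left_mono)
    have "(INF x\<in>S. r * dist p x) / r \<le> (INF x\<in>S. dist p x)"
    proof (intro cINF_greatest \<open>S \<noteq> {}\<close>)
      fix x assume "x \<in> S"
      then have "(INF x\<in>S. r * dist p x) \<le> r * dist p x" using bdd by (intro cINF_lower)
      then show "(INF x\<in>S. r * dist p x) / r \<le> dist p x" using r_pos by (simp add: field_simps)
    qed
    then show "(INF x\<in>S. r * dist p x) \<le> r * (INF x\<in>S. dist p x)" using r_pos by (simp add: field_simps)
  qed
  then show ?thesis using \<open>S \<noteq> {}\<close> by (simp add: infdist_def image_image dist_\<phi>)
qed

lemma hyperbola_with_foci_image:
  "hyperbola_with_foci (\<phi> F) (\<phi> G) (r * d) (\<phi> ` H) \<longleftrightarrow> hyperbola_with_foci F G d H"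
proof -
  have *: "\<bar>r * s - r * t\<bar> = r * d \<longleftrightarrow> \<bar>s - t\<bar> = d" for s t
    using r_pos by (simp add: abs_mult flip: right_diff_distrib)
  have "{P. \<bar>dist P (\<phi> F) - dist P (\<phi> G)\<bar> = r * d} = \<phi> ` {P. \<bar>dist P F - dist P G\<bar> = d}"
  proof (rule set_eqI)
    fix P obtain p where P: "P = \<phi> p" by (rule \<phi>_cases)
    show "P \<in> {P. \<bar>dist P (\<phi> F) - dist P (\<phi> G)\<bar> = r * d} \<longleftrightarrow>
      P \<in> \<phi> ` {P. \<bar>dist P F - dist P G\<bar> = d}"
      unfolding P \<phi>_mem_image by (simp add: dist_\<phi> *)
  qed
  then have "\<phi> ` H = {P. \<bar>dist P (\<phi> F) - dist P (\<phi> G)\<bar> = r * d}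
      \<longleftrightarrow> H = {P. \<bar>dist P F - dist P G\<bar> = d}"
    using bij_\<phi> by (simp add: inj_image_eq_iff bij_is_inj)
  then show ?thesis
    using r_pos by (auto simp: hyperbola_with_foci_def dist_\<phi> zero_less_mult_iff)
qed

lemma rectangular_hyperbola_image: "rectangular_hyperbola (\<phi> ` H) \<longleftrightarrow> rectangular_hyperbola H"
proof
  assume "rectangular_hyperbola H"
  then obtain F G d where "hyperbola_with_foci F G d H" "dist F G = sqrt 2 * d"
    by (auto simp: rectangular_hyperbola_def)
  then show "rectangular_hyperbola (\<phi> ` H)"
    unfolding rectangular_hyperbola_def
    by (intro exI[of _ "\<phi> F"] exI[of _ "\<phi> G"] exI[of _ "r * d"])
      (simp add: hyperbola_with_foci_image dist_\<phi>)
next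
  assume "rectangular_hyperbola (\<phi> ` H)"
  then obtain F G d where FG: "hyperbola_with_foci F G d (\<phi> ` H)" "dist F G = sqrt 2 * d"
    by (auto simp: rectangular_hyperbola_def)
  obtain f g where fg: "F = \<phi> f" "G = \<phi> g" by (metis \<phi>_cases)
  have d: "d = r * (d / r)" using r_pos by simp
  have "hyperbola_with_foci f g (d / r) H"
    using FG(1) by (subst (asm) d) (simp only: fg hyperbola_with_foci_image)
  moreover have "dist f g = sqrt 2 * (d / r)"
    using FG(2) r_pos by (simp add: fg dist_\<phi> field_simps)
  ultimately show "rectangular_hyperbola H"
    unfolding rectangular_hyperbola_def by blast
qed

lemma focal_length_image:
  assumes "rectangular_hyperbola H"
  shows "focal_length (\<phi> ` H) = r * focal_length H"
proof -
  obtain F G d where FG: "hyperbola_with_foci F G d H" "dist F G = sqrt 2 * d"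
    using assms by (auto simp: rectangular_hyperbola_def)
  then have "focal_length (\<phi> ` H) = dist (\<phi> F) (\<phi> G)"
    using r_pos by (intro focal_length_eq[of _ _ "r * d"]) (simp_all add: hyperbola_with_foci_image dist_\<phi>)
  then show ?thesis using focal_length_eq[OF FG] by (simp add: dist_\<phi>)
qed

end

section \<open>Triangle centers\<close>

definition det2 :: "point \<Rightarrow> point \<Rightarrow> real" where
  "det2 u v = fst u * snd v - snd u * fst v"

lemma det2_orthogonal_eq_0:
  assumes "det2 u v \<noteq> 0" "w \<bullet> u = 0" "w \<bullet> v = 0"
  shows "w = 0"
proof -
  have "det2 u v * fst w = 0" "det2 u v * snd w = 0"
    using assms(2,3) unfolding inner_prod_def det2_def inner_real_def by algebra+
  then show ?thesis using assms(1) by (simp add: prod_eq_iff)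
qed

text \<open>The difference of two squared distances is affine in the point, so two candidates differ
  by a vector orthogonal to two independent sides.\<close>

lemma circumcenter_eqI:
  assumes "det2 (B - A) (C - A) \<noteq> 0" "dist P A = dist P B" "dist P B = dist P C"
  shows "\<exists>!P. dist P A = dist P B \<and> dist P B = dist P C" and "circumcenter A B C = P"
proof -
  have *: "Q = P" if "dist Q A = dist Q B" "dist Q B = dist Q C" for Q
  proof -
    have sq: "(Q - X) \<bullet> (Q - X) = (dist Q X)\<^sup>2" "(P - X) \<bullet> (P - X) = (dist P X)\<^sup>2" for X
      by (simp_all add: dist_norm power2_norm_eq_inner)
    have "2 * ((Q - P) \<bullet> (X - A)) = (dist Q A)\<^sup>2 - (dist Q X)\<^sup>2 - (dist P A)\<^sup>2 + (dist P X)\<^sup>2" for X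
      unfolding sq[symmetric] by (simp add: inner_diff inner_commute)
    then have "(Q - P) \<bullet> (B - A) = 0" "(Q - P) \<bullet> (C - A) = 0"
      using assms that by (metis add.commute add_cancel_right_left diff_self mult_eq_0_iff zero_neq_numeral diff_add_cancel)+
    then have "Q - P = 0" by (rule det2_orthogonal_eq_0[OF assms(1)])
    then show ?thesis by simp
  qed
  show "\<exists>!P. dist P A = dist P B \<and> dist P B = dist P C" using assms * by blast
  show "circumcenter A B C = P" 
    unfolding circumcenter_def by (rule the_equality) (use assms * in blast)+
qed

lemma orthocenter_eqI:
  assumes "det2 (B - A) (C - A) \<noteq> 0"
    and P: "(P - A) \<bullet> (B - C) = 0" "(P - B) \<bullet> (C - A) = 0" "(P - C) \<bullet> (A - B) = 0"
  shows "\<exists>!P. (P - A) \<bullet> (B - C) = 0 \<and> (P - B) \<bullet> (C - A) = 0 \<and> (P - C) \<bullet> (A - B) = 0"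
    and "orthocenter A B C = P"
proof -
  have *: "Q = P" if "(Q - B) \<bullet> (C - A) = 0" "(Q - C) \<bullet> (A - B) = 0" for Q
  proof -
    have "(Q - P) \<bullet> (B - A) = 0" "(Q - P) \<bullet> (C - A) = 0"
      using that P by (simp_all add: inner_diff)
    then have "Q - P = 0" by (rule det2_orthogonal_eq_0[OF assms(1)])
    then show ?thesis by simp
  qed
  show "\<exists>!P. (P - A) \<bullet> (B - C) = 0 \<and> (P - B) \<bullet> (C - A) = 0 \<and> (P - C) \<bullet> (A - B) = 0"
    using P * by blast
  show "orthocenter A B C = P" 
    unfolding orthocenter_def by (rule the_equality) (use P * in blast)+
qed

text \<open>Two unit vectors are mirror images of each other in the line along their sum, so the
  reflection swaps the coefficients.\<close>

lemma reflect_along_unit_sum: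
  assumes "norm u = 1" "norm v = 1" "u + v \<noteq> 0"
  shows "reflect_along A (u + v) (A + (s *\<^sub>R u + t *\<^sub>R v)) = A + (t *\<^sub>R u + s *\<^sub>R v)"
proof -
  define n where "n = norm (u + v)"
  have n: "n \<noteq> 0" using assms by (simp add: n_def)
  have uu: "u \<bullet> u = 1" "v \<bullet> v = 1" using assms by (simp_all add: norm_eq_1)
  have "n\<^sup>2 = 2 * (1 + u \<bullet> v)"
    unfolding n_def power2_norm_eq_inner by (simp add: inner_add uu inner_commute)
  moreover have "(s *\<^sub>R u + t *\<^sub>R v) \<bullet> (u + v) = (s + t) * (1 + u \<bullet> v)"
    by (simp add: inner_add uu inner_commute algebra_simps)
  ultimately have *: "2 * ((s *\<^sub>R u + t *\<^sub>R v) \<bullet> (u + v)) = (s + t) * n\<^sup>2" by simp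
  have "(2 * ((s *\<^sub>R u + t *\<^sub>R v) \<bullet> sgn (u + v))) *\<^sub>R sgn (u + v) = (s + t) *\<^sub>R (u + v)"
  proof -
    have eq: "(2 * (w \<bullet> (x /\<^sub>R n))) *\<^sub>R (x /\<^sub>R n) = (2 * (w \<bullet> x) / n\<^sup>2) *\<^sub>R x" for w x :: point
      by (simp add: power2_eq_square divide_inverse)
    show ?thesis unfolding sgn_div_norm n_def[symmetric] eq * using n by simp
  qed
  then show ?thesis by (simp add: reflect_along_def algebra_simps)
qed

text \<open>Along the unit vectors of the sides the median has direction
  \<open>c * u + b * v\<close>. The reflection makes this \<open>b * u + c * v\<close>, and a
  further factor \<open>b * c\<close> produces squared side lengths.\<close>

lemma symmedian_eq:
  assumes nz: "det2 (B - A) (C - A) \<noteq> 0"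
  shows "symmedian A B C = line_along A ((dist C A)\<^sup>2 *\<^sub>R (B - A) + (dist A B)\<^sup>2 *\<^sub>R (C - A))"
proof -
  define c where "c = norm (B - A)"
  define b where "b = norm (C - A)"
  define u where "u = sgn (B - A)"
  define v where "v = sgn (C - A)"
  have "B \<noteq> A" "C \<noteq> A" using nz by (auto simp: det2_def)
  then have pos: "b > 0" "c > 0" and unit: "norm u = 1" "norm v = 1"
    by (simp_all add: b_def c_def u_def v_def norm_sgn)
  have uv: "B - A = c *\<^sub>R u" "C - A = b *\<^sub>R v"
    using pos by (simp_all add: u_def v_def b_def c_def sgn_div_norm)
  have "u + v \<noteq> 0"
  proof
    assume "u + v = 0"
    then have "v = - u" by (simp add: add_eq_0_iff)
    then show False using nz unfolding uv by (simp add: det2_def)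
  qed
  have mid: "midpoint B C - A = (c / 2) *\<^sub>R u + (b / 2) *\<^sub>R v"
  proof -
    have "midpoint B C - A = (1 / 2) *\<^sub>R ((B - A) + (C - A))"
      by (simp add: midpoint_def prod_eq_iff field_simps)
    then show ?thesis unfolding uv by (simp add: scaleR_add_right)
  qed
  have "symmedian A B C = range (\<lambda>s. reflect_along A (u + v) (A + s *\<^sub>R (midpoint B C - A)))"
    unfolding symmedian_def affine_hull_2_alt u_def v_def by (simp add: image_image)
  also have "\<dots> = range (\<lambda>s. A + s *\<^sub>R ((b / 2) *\<^sub>R u + (c / 2) *\<^sub>R v))"
  proof (rule arg_cong[where f = range], rule ext)
    fix s
    have "reflect_along A (u + v) (A + s *\<^sub>R (midpoint B C - A))
      = reflect_along A (u + v) (A + ((s * (c / 2)) *\<^sub>R u + (s * (b / 2)) *\<^sub>R v))"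
      unfolding mid by (simp add: scaleR_add_right)
    also have "\<dots> = A + s *\<^sub>R ((b / 2) *\<^sub>R u + (c / 2) *\<^sub>R v)"
      unfolding reflect_along_unit_sum[OF unit \<open>u + v \<noteq> 0\<close>] by (simp add: scaleR_add_right)
    finally show "reflect_along A (u + v) (A + s *\<^sub>R (midpoint B C - A))
      = A + s *\<^sub>R ((b / 2) *\<^sub>R u + (c / 2) *\<^sub>R v)" .
  qed
  also have "\<dots> = line_along A ((b / 2) *\<^sub>R u + (c / 2) *\<^sub>R v)" by (simp add: line_along_def)
  also have "\<dots> = line_along A ((2 * b * c) *\<^sub>R ((b / 2) *\<^sub>R u + (c / 2) *\<^sub>R v))"
    using pos by (simp add: line_along_scaleR)
  also have "(2 * b * c) *\<^sub>R ((b / 2) *\<^sub>R u + (c / 2) *\<^sub>R v) = b\<^sup>2 *\<^sub>R (B - A) + c\<^sup>2 *\<^sub>R (C - A)"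
    unfolding uv by (simp add: scaleR_add_right power2_eq_square mult_ac)
  finally show ?thesis by (simp add: b_def c_def dist_norm norm_minus_commute)
qed

lemma lines_meet_once:
  assumes "det2 u v \<noteq> 0" "P \<in> line_along A u" "P \<in> line_along B v" "Q \<in> line_along A u" "Q \<in> line_along B v"
  shows "P = Q"
proof -
  obtain s t s' t' where eqs: "P = A + s *\<^sub>R u" "P = B + t *\<^sub>R v"
      "Q = A + s' *\<^sub>R u" "Q = B + t' *\<^sub>R v"
    using assms(2-) unfolding line_along_def by blast
  have u: "P - Q = (s - s') *\<^sub>R u" unfolding eqs(1,3) by (simp add: scaleR_diff_left)
  have v: "P - Q = (t - t') *\<^sub>R v" unfolding eqs(2,4) by (simp add: scaleR_diff_left)
  have "(s - s') * det2 u v = det2 ((s - s') *\<^sub>R u) v" by (simp add: det2_def algebra_simps)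
  also have "\<dots> = 0" unfolding u[symmetric] v by (simp add: det2_def)
  finally show ?thesis using assms(1) u by simp
qed

text \<open>These are the classical barycentric weights, the squares of the opposite sides.
  Splitting off \<open>k\<close> leaves room for polynomial weights.\<close>

lemma symmedian_point_eqI:
  assumes nz: "det2 (B - A) (C - A) \<noteq> 0"
    and w: "(dist B C)\<^sup>2 = k * wa" "(dist C A)\<^sup>2 = k * wb" "(dist A B)\<^sup>2 = k * wc"
    and P: "(wa + wb + wc) *\<^sub>R P = wa *\<^sub>R A + wb *\<^sub>R B + wc *\<^sub>R C"
  shows "\<exists>!P. P \<in> symmedian A B C \<and> P \<in> symmedian B C A \<and> P \<in> symmedian C A B"
    and "symmedian_point A B C = P"
proof -
  have nz': "det2 (C - B) (A - B) \<noteq> 0" "det2 (A - C) (B - C) \<noteq> 0"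
    using nz by (simp_all add: det2_def algebra_simps)
  have "B \<noteq> A" "C \<noteq> A" "B \<noteq> C" using nz by (auto simp: det2_def)
  then have "0 < k * wa" "0 < k * wb" "0 < k * wc" by (simp_all flip: w)
  then have k: "k \<noteq> 0" and pos: "0 < k * (wa + wb + wc)" and wnz: "wb \<noteq> 0" "wa \<noteq> 0" "wc \<noteq> 0"
    by (auto simp: algebra_simps)
  then have s: "wa + wb + wc \<noteq> 0" by auto
  note sym = symmedian_eq[OF nz] symmedian_eq[OF nz'(1)] symmedian_eq[OF nz'(2)]
  \<comment> \<open>The order of the vertices is kept arbitrary here to serve all three cyclic
    cases.\<close>
  have on: "P \<in> line_along X ((k * wy) *\<^sub>R (Y - X) + (k * wz) *\<^sub>R (Z - X))"
    if "(wa + wb + wc) *\<^sub>R P = wx *\<^sub>R X + wy *\<^sub>R Y + wz *\<^sub>R Z" "wx + wy + wz = wa + wb + wc" for X Y Z wx wy wz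
  proof -
    have "(wa + wb + wc) *\<^sub>R (P - X) = wy *\<^sub>R (Y - X) + wz *\<^sub>R (Z - X)"
      unfolding scaleR_diff_right that(1) unfolding that(2)[symmetric] by (simp add: algebra_simps)
    then have "P - X = (1 / (wa + wb + wc)) *\<^sub>R (wy *\<^sub>R (Y - X) + wz *\<^sub>R (Z - X))"
      using s by (metis (no_types, lifting) divide_self_if scaleR_one scaleR_scaleR times_divide_eq_left mult_1)
    then have "P = X + (1 / (k * (wa + wb + wc))) *\<^sub>R ((k * wy) *\<^sub>R (Y - X) + (k * wz) *\<^sub>R (Z - X))"
      using k by (simp add: scaleR_add_right diff_eq_eq)
    then show ?thesis unfolding line_along_def by blast
  qed
  have "P \<in> symmedian A B C" unfolding sym w by (rule on[OF P]) simp
  moreover have "P \<in> symmedian B C A" unfolding sym w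
    by (rule on[of wb B wc C wa A]) (use P in \<open>simp_all add: add_ac\<close>)
  moreover have "P \<in> symmedian C A B" unfolding sym w
    by (rule on[of wc C wa A wb B]) (use P in \<open>simp_all add: add_ac\<close>)
  moreover have "Q = P" if "Q \<in> symmedian A B C" "Q \<in> symmedian B C A" for Q
  proof (rule lines_meet_once)
    have "det2 ((k * wb) *\<^sub>R (B - A) + (k * wc) *\<^sub>R (C - A)) ((k * wc) *\<^sub>R (C - B) + (k * wa) *\<^sub>R (A - B))
      = k * wc * (k * (wa + wb + wc)) * det2 (B - A) (C - A)"
      by (simp add: det2_def) algebra
    then show "det2 ((k * wb) *\<^sub>R (B - A) + (k * wc) *\<^sub>R (C - A)) ((k * wc) *\<^sub>R (C - B) + (k * wa) *\<^sub>R (A - B)) \<noteq> 0"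
      using nz s k wnz by simp
  qed (use that \<open>P \<in> symmedian A B C\<close> \<open>P \<in> symmedian B C A\<close> in \<open>simp_all add: sym w\<close>)
  ultimately have P3: "P \<in> symmedian A B C \<and> P \<in> symmedian B C A \<and> P \<in> symmedian C A B"
    and u: "\<And>Q. Q \<in> symmedian A B C \<and> Q \<in> symmedian B C A \<and> Q \<in> symmedian C A B \<Longrightarrow> Q = P" by blast+
  then show "\<exists>!P. P \<in> symmedian A B C \<and> P \<in> symmedian B C A \<and> P \<in> symmedian C A B" by blast
  show "symmedian_point A B C = P" unfolding symmedian_point_def using P3 u by (rule the_equality)
qed

section \<open>Triangles with incenter 0 and inradius 1\<close>

lemma sgn_scaleR_unit: "0 < c \<Longrightarrow> norm u = 1 \<Longrightarrow> sgn (c *\<^sub>R u) = u" for u :: point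
  by (simp add: sgn_div_norm)

text \<open>A bisector directed along its own vertex runs through \<open>0\<close> and gets an
  implicit equation: \<open>det2 P X\<close> is, up to scale, the component of \<open>P\<close>
  transverse to \<open>X\<close>.\<close>

lemma internal_bisector_through_0:
  assumes "sgn (Y - X) + sgn (Z - X) = k *\<^sub>R X" "k \<noteq> 0" "X \<noteq> 0"
  shows "internal_bisector X Y Z = {P. det2 P X = 0}"
proof -
  have "internal_bisector X Y Z = line_along X X"
    unfolding internal_bisector_def assms(1) by (rule line_along_scaleR[OF assms(2)])
  also have "\<dots> = {P. det2 P X = 0}"
  proof (intro set_eqI iffI)
    fix P assume "P \<in> {P. det2 P X = 0}"
    then have "det2 P X = 0" by simp
    moreover have "(X \<bullet> X) *\<^sub>R P = (P \<bullet> X) *\<^sub>R X + det2 P X *\<^sub>R (snd X, - fst X)"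
      by (cases P, cases X) (simp add: det2_def algebra_simps)
    ultimately have *: "(X \<bullet> X) *\<^sub>R P = (P \<bullet> X) *\<^sub>R X" by (simp flip: zero_prod_def)
    have "P = (1 / (X \<bullet> X)) *\<^sub>R ((X \<bullet> X) *\<^sub>R P)" using assms(3) by simp
    also have "\<dots> = X + ((P \<bullet> X) / (X \<bullet> X) - 1) *\<^sub>R X"
      unfolding * by (simp add: algebra_simps)
    finally show "P \<in> line_along X X" unfolding line_along_def by blast
  qed (auto simp: line_along_def det2_def algebra_simps)
  finally show ?thesis .
qed

lemma external_bisector_through_0:
  assumes "sgn (Y - X) - sgn (Z - X) = l *\<^sub>R (- snd X, fst X)" "l \<noteq> 0" "X \<noteq> 0"
  shows "external_bisector X Y Z = {P. P \<bullet> X = X \<bullet> X}"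
proof -
  have "external_bisector X Y Z = line_along X (- snd X, fst X)"
    unfolding external_bisector_def assms(1) by (rule line_along_scaleR[OF assms(2)])
  also have "\<dots> = {P. P \<bullet> X = X \<bullet> X}"
  proof (intro set_eqI iffI)
    fix P assume "P \<in> {P. P \<bullet> X = X \<bullet> X}"
    then have "P \<bullet> X = X \<bullet> X" by simp
    moreover have "(X \<bullet> X) *\<^sub>R P = (P \<bullet> X) *\<^sub>R X + det2 X P *\<^sub>R (- snd X, fst X)"
      by (cases P, cases X) (simp add: det2_def algebra_simps)
    ultimately have *: "(X \<bullet> X) *\<^sub>R P = (X \<bullet> X) *\<^sub>R X + det2 X P *\<^sub>R (- snd X, fst X)" by simp
    have "P = (1 / (X \<bullet> X)) *\<^sub>R ((X \<bullet> X) *\<^sub>R P)" using assms(3) by simp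
    also have "\<dots> = X + (det2 X P / (X \<bullet> X)) *\<^sub>R (- snd X, fst X)"
      unfolding * using assms(3) by (simp add: scaleR_add_right)
    finally show "P \<in> line_along X (- snd X, fst X)" unfolding line_along_def by blast
  qed (auto simp: line_along_def inner_prod_def algebra_simps)
  finally show ?thesis .
qed

text \<open>The incenter is \<open>0\<close>, the inradius is \<open>1\<close>, and \<open>y\<close>, \<open>z\<close> are the tangent lengths at \<open>B\<close>, \<open>C\<close>,
  i.e. the cotangents of the half angles there. The third tangent length is \<open>(y + z) / m\<close>, and
  the circumradius is \<open>W / (4 * m)\<close>.\<close>

locale canonical_triangle =
  fixes y z :: real
  assumes y_pos: "0 < y" and z_pos: "0 < z" and yz: "1 < y * z"
begin

definition m :: real where "m = y * z - 1"
text \<open>The product of the squared distances of \<open>B\<close> and \<open>C\<close> from the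
  incenter.\<close>

definition W :: real where "W = (1 + y\<^sup>2) * (1 + z\<^sup>2)"
definition A :: point where "A = ((y - z) / m, (y * z + 1) / m)"
definition B :: point where "B = (- y, - 1)"
definition C :: point where "C = (z, - 1)"

lemma m_pos: "0 < m" and W_pos: "0 < W"
  using yz by (auto simp: m_def W_def intro!: mult_pos_pos add_pos_nonneg)

lemma W_eq: "W = (y - z)\<^sup>2 + (m + 2)\<^sup>2"
  unfolding W_def m_def by algebra

lemma y2z2_pos: "0 < 1 + y\<^sup>2" "0 < 1 + z\<^sup>2"
  by (simp_all add: add_pos_nonneg)

text \<open>As \<open>y\<close> and \<open>z\<close> are cotangents of half angles, these are the
  rational forms of \<open>(- cos, - sin)\<close> of the angle at \<open>B\<close> and of
  \<open>(cos, - sin)\<close> of the angle at \<open>C\<close>.\<close>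

lemma unit_vectors:
  "norm ((1 - y\<^sup>2) / (1 + y\<^sup>2), - 2 * y / (1 + y\<^sup>2)) = 1"
  "norm ((z\<^sup>2 - 1) / (1 + z\<^sup>2), - 2 * z / (1 + z\<^sup>2)) = 1"
proof -
  have *: "norm (u / w, v / w) = 1" if "0 < w" "u\<^sup>2 + v\<^sup>2 = w\<^sup>2" for u v w :: real
    using that by (simp add: norm_Pair power_divide add_divide_distrib[symmetric])
  show "norm ((1 - y\<^sup>2) / (1 + y\<^sup>2), - 2 * y / (1 + y\<^sup>2)) = 1"
    by (rule *[OF y2z2_pos(1)]) algebra
  show "norm ((z\<^sup>2 - 1) / (1 + z\<^sup>2), - 2 * z / (1 + z\<^sup>2)) = 1"
    by (rule *[OF y2z2_pos(2)]) algebra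
qed

lemma sides:
  "B - A = (z * (1 + y\<^sup>2) / m) *\<^sub>R ((1 - y\<^sup>2) / (1 + y\<^sup>2), - 2 * y / (1 + y\<^sup>2))"
  "C - A = (y * (1 + z\<^sup>2) / m) *\<^sub>R ((z\<^sup>2 - 1) / (1 + z\<^sup>2), - 2 * z / (1 + z\<^sup>2))"
  "C - B = (y + z) *\<^sub>R (1, 0)"
proof -
  have [simp]: "1 + y\<^sup>2 \<noteq> 0" "1 + z\<^sup>2 \<noteq> 0" "m \<noteq> 0" using y2z2_pos m_pos by auto
  show "B - A = (z * (1 + y\<^sup>2) / m) *\<^sub>R ((1 - y\<^sup>2) / (1 + y\<^sup>2), - 2 * y / (1 + y\<^sup>2))"
    by (simp add: A_def B_def divide_simps) (simp add: m_def power2_eq_square algebra_simps)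
  show "C - A = (y * (1 + z\<^sup>2) / m) *\<^sub>R ((z\<^sup>2 - 1) / (1 + z\<^sup>2), - 2 * z / (1 + z\<^sup>2))"
    by (simp add: A_def C_def divide_simps) (simp add: m_def power2_eq_square algebra_simps)
  show "C - B = (y + z) *\<^sub>R (1, 0)" by (simp add: B_def C_def)
qed

lemma side_dists:
  "dist B C = y + z" "dist C A = y * (1 + z\<^sup>2) / m" "dist A B = z * (1 + y\<^sup>2) / m"
proof -
  have *: "norm X = c" if "X = c *\<^sub>R u" "norm u = 1" "0 < c" for X u :: point and c
    using that by simp
  show "dist B C = y + z"
    using *[OF sides(3)] y_pos z_pos by (simp add: dist_norm norm_minus_commute)
  show "dist C A = y * (1 + z\<^sup>2) / m"
    unfolding dist_norm using *[OF sides(2) unit_vectors(2)] y_pos m_pos y2z2_pos by simp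
  show "dist A B = z * (1 + y\<^sup>2) / m"
    unfolding dist_norm norm_minus_commute[of A]
    using *[OF sides(1) unit_vectors(1)] z_pos m_pos y2z2_pos by simp
qed

lemma sgn_sides:
  "sgn (B - A) = ((1 - y\<^sup>2) / (1 + y\<^sup>2), - 2 * y / (1 + y\<^sup>2))"
  "sgn (C - A) = ((z\<^sup>2 - 1) / (1 + z\<^sup>2), - 2 * z / (1 + z\<^sup>2))"
  "sgn (C - B) = (1, 0)"
  "sgn (A - B) = - ((1 - y\<^sup>2) / (1 + y\<^sup>2), - 2 * y / (1 + y\<^sup>2))"
  "sgn (A - C) = - ((z\<^sup>2 - 1) / (1 + z\<^sup>2), - 2 * z / (1 + z\<^sup>2))"
  "sgn (B - C) = - (1, 0)"
proof -
  have pos: "0 < z * (1 + y\<^sup>2) / m" "0 < y * (1 + z\<^sup>2) / m" "0 < y + z"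
    using y_pos z_pos m_pos y2z2_pos by simp_all
  show 1: "sgn (B - A) = ((1 - y\<^sup>2) / (1 + y\<^sup>2), - 2 * y / (1 + y\<^sup>2))"
    unfolding sides by (rule sgn_scaleR_unit[OF pos(1) unit_vectors(1)])
  show 2: "sgn (C - A) = ((z\<^sup>2 - 1) / (1 + z\<^sup>2), - 2 * z / (1 + z\<^sup>2))"
    unfolding sides by (rule sgn_scaleR_unit[OF pos(2) unit_vectors(2)])
  show 3: "sgn (C - B) = (1, 0)"
    unfolding sides by (rule sgn_scaleR_unit[OF pos(3)]) simp
  show "sgn (A - B) = - ((1 - y\<^sup>2) / (1 + y\<^sup>2), - 2 * y / (1 + y\<^sup>2))"
    "sgn (A - C) = - ((z\<^sup>2 - 1) / (1 + z\<^sup>2), - 2 * z / (1 + z\<^sup>2))" "sgn (B - C) = - (1, 0)"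
    unfolding 1[symmetric] 2[symmetric] 3[symmetric] sgn_minus[symmetric] by simp_all
qed

lemma vertices_nonzero: "A \<noteq> 0" "B \<noteq> 0" "C \<noteq> 0"
  using yz by (auto simp: A_def B_def C_def m_def zero_prod_def)

text \<open>Up to sign, the factors \<open>k\<close> and \<open>l\<close> are \<open>2 * cos\<close>
  and \<open>2 * sin\<close> of the half angle, divided by the distance of the vertex from
  \<open>0\<close>.\<close>

lemma bisectors:
  "internal_bisector A B C = {P. det2 P A = 0}" "external_bisector A B C = {P. P \<bullet> A = A \<bullet> A}"
  "internal_bisector B C A = {P. det2 P B = 0}" "external_bisector B C A = {P. P \<bullet> B = B \<bullet> B}"
  "internal_bisector C A B = {P. det2 P C = 0}" "external_bisector C A B = {P. P \<bullet> C = C \<bullet> C}"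
proof -
  have nz [simp]: "1 + y\<^sup>2 \<noteq> 0" "1 + z\<^sup>2 \<noteq> 0" "m \<noteq> 0" "y \<noteq> 0" "z \<noteq> 0" "y + z \<noteq> 0" "W \<noteq> 0"
    using y2z2_pos m_pos y_pos z_pos W_pos by auto
  show "internal_bisector A B C = {P. det2 P A = 0}"
  proof (rule internal_bisector_through_0[where k = "- 2 * (y + z) * m / W"])
    show "sgn (B - A) + sgn (C - A) = (- 2 * (y + z) * m / W) *\<^sub>R A"
      unfolding sgn_sides unfolding A_def W_def
      by (simp add: divide_simps) (simp add: power2_eq_square algebra_simps)
  qed (use vertices_nonzero y_pos z_pos in auto)
  show "external_bisector A B C = {P. P \<bullet> A = A \<bullet> A}"
  proof (rule external_bisector_through_0[where l = "2 * m\<^sup>2 / W"])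
    show "sgn (B - A) - sgn (C - A) = (2 * m\<^sup>2 / W) *\<^sub>R (- snd A, fst A)"
      unfolding sgn_sides unfolding A_def W_def
      by (simp add: divide_simps) (simp add: m_def power2_eq_square algebra_simps)
  qed (use vertices_nonzero in auto)
  show "internal_bisector B C A = {P. det2 P B = 0}"
  proof (rule internal_bisector_through_0[where k = "- 2 * y / (1 + y\<^sup>2)"])
    show "sgn (C - B) + sgn (A - B) = (- 2 * y / (1 + y\<^sup>2)) *\<^sub>R B"
      unfolding sgn_sides unfolding B_def
      by (simp add: divide_simps) (simp add: power2_eq_square)
  qed (use vertices_nonzero in auto)
  show "external_bisector B C A = {P. P \<bullet> B = B \<bullet> B}"
  proof (rule external_bisector_through_0[where l = "2 / (1 + y\<^sup>2)"])
    show "sgn (C - B) - sgn (A - B) = (2 / (1 + y\<^sup>2)) *\<^sub>R (- snd B, fst B)"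
      unfolding sgn_sides unfolding B_def by (simp add: divide_simps)
  qed (use vertices_nonzero in auto)
  show "internal_bisector C A B = {P. det2 P C = 0}"
  proof (rule internal_bisector_through_0[where k = "- 2 * z / (1 + z\<^sup>2)"])
    show "sgn (A - C) + sgn (B - C) = (- 2 * z / (1 + z\<^sup>2)) *\<^sub>R C"
      unfolding sgn_sides unfolding C_def
      by (simp add: divide_simps) (simp add: power2_eq_square)
  qed (use vertices_nonzero in auto)
  show "external_bisector C A B = {P. P \<bullet> C = C \<bullet> C}"
  proof (rule external_bisector_through_0[where l = "2 / (1 + z\<^sup>2)"])
    show "sgn (A - C) - sgn (B - C) = (2 / (1 + z\<^sup>2)) *\<^sub>R (- snd C, fst C)"
      unfolding sgn_sides unfolding C_def by (simp add: divide_simps)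
  qed (use vertices_nonzero in auto)
qed

section \<open>Incenter and excenters\<close>

lemma incenter_unique:
  "P \<in> internal_bisector A B C \<and> P \<in> internal_bisector B C A \<and> P \<in> internal_bisector C A B
    \<longleftrightarrow> P = 0"
proof
  assume P: "P \<in> internal_bisector A B C \<and> P \<in> internal_bisector B C A \<and> P \<in> internal_bisector C A B"
  then have "fst P = y * snd P" "fst P = - z * snd P"
    unfolding bisectors by (auto simp: det2_def B_def C_def mult_ac)
  then have "(y + z) * snd P = 0" by algebra
  then show "P = 0" using y_pos z_pos \<open>fst P = y * snd P\<close> by (simp add: prod_eq_iff)
qed (simp add: bisectors det2_def)

text \<open>The excenters; \<open>U\<close> and \<open>H0\<close> are the circumcenter and the orthocenter, \<open>V\<close> and \<open>K\<close> the
  circumcenter and the symmedian point of the excentral triangle, whose orthocenter is \<open>0\<close>.\<close>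

definition JA :: point where "JA = (z - y, - (y * z + 1))"
definition JB :: point where "JB = (y * (1 + z\<^sup>2) / m, (1 + z\<^sup>2) / m)"
definition JC :: point where "JC = (- z * (1 + y\<^sup>2) / m, (1 + y\<^sup>2) / m)"

lemma excenter_A_unique:
  "P \<in> internal_bisector A B C \<and> P \<in> external_bisector B C A \<and> P \<in> external_bisector C A B
    \<longleftrightarrow> P = JA" (is "?L \<longleftrightarrow> _")
proof
  assume ?L
  then have e: "- y * fst P - snd P = y\<^sup>2 + 1" "z * fst P - snd P = z\<^sup>2 + 1"
    unfolding bisectors by (auto simp: inner_prod_def B_def C_def power2_eq_square mult_ac)
  then have "(y + z) * (fst P - (z - y)) = 0" by algebra
  then have "fst P = z - y" using y_pos z_pos by simp
  moreover from this have "snd P = - (y * z + 1)" using e by algebra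
  ultimately show "P = JA" by (simp add: JA_def prod_eq_iff)
next
  assume "P = JA"
  then show ?L unfolding bisectors using m_pos
    by (simp add: det2_def inner_prod_def A_def B_def C_def JA_def power2_eq_square field_simps)
qed

lemma excenter_B_unique:
  "P \<in> internal_bisector B C A \<and> P \<in> external_bisector C A B \<and> P \<in> external_bisector A B C
    \<longleftrightarrow> P = JB" (is "?L \<longleftrightarrow> _")
proof
  assume ?L
  then have e: "fst P = y * snd P" "z * fst P - snd P = z\<^sup>2 + 1"
    unfolding bisectors by (auto simp: inner_prod_def det2_def B_def C_def power2_eq_square mult_ac)
  then have "m * snd P = 1 + z\<^sup>2" unfolding m_def by algebra
  then show "P = JB" using e(1) m_pos by (simp add: JB_def prod_eq_iff field_simps)
next
  assume P: "P = JB"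
  have "m * (fst P * (y - z) + snd P * (y * z + 1)) = (y - z)\<^sup>2 + (y * z + 1)\<^sup>2"
    using m_pos unfolding P JB_def by (simp add: field_simps) algebra
  then have "P \<bullet> A = A \<bullet> A"
    using m_pos unfolding A_def by (simp add: inner_prod_def field_simps power2_eq_square)
  moreover have "P \<bullet> C = C \<bullet> C"
    using m_pos unfolding P JB_def C_def
    by (simp add: inner_prod_def field_simps) (simp add: m_def power2_eq_square algebra_simps)
  ultimately show ?L unfolding bisectors by (simp add: P det2_def B_def JB_def)
qed

lemma excenter_C_unique:
  "P \<in> internal_bisector C A B \<and> P \<in> external_bisector A B C \<and> P \<in> external_bisector B C A
    \<longleftrightarrow> P = JC" (is "?L \<longleftrightarrow> _")
proof
  assume ?L
  then have e: "fst P = - z * snd P" "- y * fst P - snd P = y\<^sup>2 + 1"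
    unfolding bisectors by (auto simp: inner_prod_def det2_def B_def C_def power2_eq_square mult_ac)
  then have "m * snd P = 1 + y\<^sup>2" unfolding m_def by algebra
  then show "P = JC" using e(1) m_pos by (simp add: JC_def prod_eq_iff field_simps)
next
  assume P: "P = JC"
  have "m * (fst P * (y - z) + snd P * (y * z + 1)) = (y - z)\<^sup>2 + (y * z + 1)\<^sup>2"
    using m_pos unfolding P JC_def by (simp add: field_simps) algebra
  then have "P \<bullet> A = A \<bullet> A"
    using m_pos unfolding A_def by (simp add: inner_prod_def field_simps power2_eq_square)
  moreover have "P \<bullet> B = B \<bullet> B"
    using m_pos unfolding P JC_def B_def
    by (simp add: inner_prod_def field_simps) (simp add: m_def power2_eq_square algebra_simps)
  ultimately show ?L unfolding bisectors by (simp add: P det2_def C_def JC_def)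
qed

lemma incenter_eq: "incenter A B C = 0"
  and excenter_eq: "excenter A B C = JA" "excenter B C A = JB" "excenter C A B = JC"
  unfolding incenter_def excenter_def incenter_unique excenter_A_unique excenter_B_unique
    excenter_C_unique by simp_all

section \<open>Circumcenter, radii and orthocenter\<close>

definition U :: point where "U = ((z - y) / 2, W / (4 * m) - m / 2 - 1)"

lemma det2_ABC: "det2 (B - A) (C - A) \<noteq> 0"
proof -
  have "det2 (B - A) (C - A) = 2 * y * z * (y + z) / m"
    using m_pos unfolding A_def B_def C_def det2_def
    by (simp add: field_simps) (simp add: m_def power2_eq_square algebra_simps)
  then show ?thesis using m_pos y_pos z_pos by simp
qed

lemma dist_U: "dist U A = W / (4 * m)" "dist U B = W / (4 * m)" "dist U C = W / (4 * m)"
proof -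
  have m: "m \<noteq> 0" using m_pos by simp
  have *: "dist U X = W / (4 * m)" if "(fst U - fst X)\<^sup>2 + (snd U - snd X)\<^sup>2 = (W / (4 * m))\<^sup>2" for X
    using that m_pos W_pos dist_prod_sq[of U X] by (simp add: power2_eq_iff_nonneg)
  show "dist U A = W / (4 * m)"
    by (rule *, unfold U_def A_def fst_conv snd_conv W_def m_def)
      (insert m, simp add: m_def divide_simps, algebra)
  show "dist U B = W / (4 * m)"
    by (rule *, unfold U_def B_def fst_conv snd_conv W_def m_def)
      (insert m, simp add: m_def divide_simps, algebra)
  show "dist U C = W / (4 * m)"
    by (rule *, unfold U_def C_def fst_conv snd_conv W_def m_def)
      (insert m, simp add: m_def divide_simps, algebra)
qed

lemma circumcenter_unique: "\<exists>!P. dist P A = dist P B \<and> dist P B = dist P C"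
  and circumcenter_eq: "circumcenter A B C = U"
  using circumcenter_eqI[OF det2_ABC, of U] by (simp_all add: dist_U)

lemma circumradius_eq: "circumradius A B C = W / (4 * m)"
  by (simp add: circumradius_def circumcenter_eq dist_U)

lemma inradius_eq: "inradius A B C = 1"
proof -
  have hull: "affine hull {B, C} = {P. snd P = - 1}"
  proof (intro set_eqI iffI)
    fix P :: point assume "P \<in> {P. snd P = - 1}"
    moreover have "(fst P + y) / (y + z) * (z + y) = fst P + y"
      using y_pos z_pos by (simp add: add.commute[of z y])
    ultimately have "P = B + ((fst P + y) / (y + z)) *\<^sub>R (C - B)"
      by (simp add: B_def C_def prod_eq_iff)
    then show "P \<in> affine hull {B, C}" unfolding affine_hull_2_alt by blast
  qed (auto simp: affine_hull_2_alt B_def C_def)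
  have "infdist 0 (affine hull {B, C}) = 1"
  proof (rule antisym)
    have "infdist 0 (affine hull {B, C}) \<le> dist 0 (0 :: real, - 1 :: real)"
      by (rule infdist_le) (simp add: hull)
    then show "infdist 0 (affine hull {B, C}) \<le> 1" by (simp add: dist_norm norm_Pair)
    have "1 \<le> dist 0 P" if "P \<in> affine hull {B, C}" for P
      using that norm_snd_le[of "snd P" "fst P"] by (cases P) (simp add: hull)
    then show "1 \<le> infdist 0 (affine hull {B, C})"
      unfolding infdist_def by (auto simp: hull intro!: cINF_greatest exI[of _ 0])
  qed
  then show ?thesis by (simp add: inradius_def incenter_eq)
qed

definition H0 :: point where "H0 = ((y - z) / m, (y\<^sup>2 - 1) * (z\<^sup>2 - 1) / (2 * m) - 1)"

lemma orthocenter_H0: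
  "(H0 - A) \<bullet> (B - C) = 0" "(H0 - B) \<bullet> (C - A) = 0" "(H0 - C) \<bullet> (A - B) = 0"
proof -
  have m: "m \<noteq> 0" using m_pos by simp
  show "(H0 - A) \<bullet> (B - C) = 0" by (simp add: H0_def A_def B_def C_def inner_prod_def)
  show "(H0 - B) \<bullet> (C - A) = 0"
    unfolding H0_def A_def B_def C_def m_def
    by (insert m, simp add: inner_prod_def m_def divide_simps, algebra)
  show "(H0 - C) \<bullet> (A - B) = 0"
    unfolding H0_def A_def B_def C_def m_def
    by (insert m, simp add: inner_prod_def m_def divide_simps, algebra)
qed

lemma orthocenter_unique:
    "\<exists>!P. (P - A) \<bullet> (B - C) = 0 \<and> (P - B) \<bullet> (C - A) = 0 \<and> (P - C) \<bullet> (A - B) = 0"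
  and orthocenter_eq: "orthocenter A B C = H0"
  using orthocenter_eqI[OF det2_ABC orthocenter_H0] by simp_all

section \<open>Centers of the excentral triangle\<close>

lemma det2_J: "det2 (JB - JA) (JC - JA) \<noteq> 0"
proof -
  have "det2 (JB - JA) (JC - JA) = W * (y + z) * (m + 1) / m\<^sup>2"
    unfolding JA_def JB_def JC_def det2_def W_def using m_pos
    by (simp add: divide_simps) (simp add: m_def, algebra)
  then show ?thesis using m_pos W_pos y_pos z_pos by simp
qed

definition V :: point where "V = (z - y, W / (2 * m) - m - 2)"

text \<open>\<open>V\<close> is \<open>2 *\<^sub>R U\<close>, and the radius doubles too: the
  circumcircle of the triangle is the nine-point circle of the excentral triangle, whose orthocenter
  is \<open>0\<close>.\<close>

lemma dist_V: "dist V JA = W / (2 * m)" "dist V JB = W / (2 * m)" "dist V JC = W / (2 * m)"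
proof -
  have m: "m \<noteq> 0" using m_pos by simp
  have *: "dist V X = W / (2 * m)" if "(fst V - fst X)\<^sup>2 + (snd V - snd X)\<^sup>2 = (W / (2 * m))\<^sup>2" for X
    using that m_pos W_pos dist_prod_sq[of V X] by (simp add: power2_eq_iff_nonneg)
  show "dist V JA = W / (2 * m)"
    by (rule *, simp only: V_def JA_def fst_conv snd_conv, simp add: m_def)
  show "dist V JB = W / (2 * m)"
    by (rule *, unfold V_def JB_def fst_conv snd_conv W_def m_def)
      (insert m, simp add: m_def divide_simps, algebra)
  show "dist V JC = W / (2 * m)"
    by (rule *, unfold V_def JC_def fst_conv snd_conv W_def m_def)
      (insert m, simp add: m_def divide_simps, algebra)
qed

lemma circumcenter_J_unique: "\<exists>!P. dist P JA = dist P JB \<and> dist P JB = dist P JC"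
  and circumcenter_J_eq: "circumcenter JA JB JC = V"
  using circumcenter_eqI[OF det2_J, of V] by (simp_all add: dist_V)

lemma orthocenter_J_0:
  "(0 - JA) \<bullet> (JB - JC) = 0" "(0 - JB) \<bullet> (JC - JA) = 0" "(0 - JC) \<bullet> (JA - JB) = 0"
proof -
  have m: "m \<noteq> 0" using m_pos by simp
  show "(0 - JA) \<bullet> (JB - JC) = 0" unfolding JA_def JB_def JC_def m_def
    by (insert m, simp add: inner_prod_def m_def divide_simps, algebra)
  show "(0 - JB) \<bullet> (JC - JA) = 0" unfolding JA_def JB_def JC_def m_def
    by (insert m, simp add: inner_prod_def m_def divide_simps, algebra)
  show "(0 - JC) \<bullet> (JA - JB) = 0" unfolding JA_def JB_def JC_def m_def
    by (insert m, simp add: inner_prod_def m_def divide_simps, algebra)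
qed

lemma orthocenter_J_unique:
    "\<exists>!P. (P - JA) \<bullet> (JB - JC) = 0 \<and> (P - JB) \<bullet> (JC - JA) = 0 \<and> (P - JC) \<bullet> (JA - JB) = 0"
  and orthocenter_J_eq: "orthocenter JA JB JC = 0"
  using orthocenter_eqI[OF det2_J orthocenter_J_0] by simp_all

definition S :: real where "S = (y + z)\<^sup>2 + y\<^sup>2 * (1 + z\<^sup>2) + z\<^sup>2 * (1 + y\<^sup>2)"

definition K :: point where
  "K = (1 / S) *\<^sub>R ((y + z)\<^sup>2 *\<^sub>R JA + (y\<^sup>2 * (1 + z\<^sup>2)) *\<^sub>R JB + (z\<^sup>2 * (1 + y\<^sup>2)) *\<^sub>R JC)"

lemma S_pos: "0 < S"
  unfolding S_def using y_pos z_pos by (intro add_pos_pos mult_pos_pos zero_less_power) auto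

text \<open>The common factor \<open>W / m\<^sup>2\<close> serves as the \<open>k\<close> of
  \<open>symmedian_point_eqI\<close>; the remaining weights add up to \<open>S\<close>.\<close>

lemma dist_J:
  "(dist JB JC)\<^sup>2 = W / m\<^sup>2 * (y + z)\<^sup>2"
  "(dist JC JA)\<^sup>2 = W / m\<^sup>2 * (y\<^sup>2 * (1 + z\<^sup>2))"
  "(dist JA JB)\<^sup>2 = W / m\<^sup>2 * (z\<^sup>2 * (1 + y\<^sup>2))"
proof -
  have m: "m \<noteq> 0" using m_pos by simp
  show "(dist JB JC)\<^sup>2 = W / m\<^sup>2 * (y + z)\<^sup>2"
    unfolding dist_prod_sq JB_def JC_def fst_conv snd_conv W_def m_def
    by (insert m, simp add: m_def divide_simps, algebra)
  show "(dist JC JA)\<^sup>2 = W / m\<^sup>2 * (y\<^sup>2 * (1 + z\<^sup>2))"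
    unfolding dist_prod_sq JA_def JC_def fst_conv snd_conv W_def m_def
    by (insert m, simp add: m_def divide_simps, algebra)
  show "(dist JA JB)\<^sup>2 = W / m\<^sup>2 * (z\<^sup>2 * (1 + y\<^sup>2))"
    unfolding dist_prod_sq JA_def JB_def fst_conv snd_conv W_def m_def
    by (insert m, simp add: m_def divide_simps, algebra)
qed

lemma symmedian_point_J_unique:
    "\<exists>!P. P \<in> symmedian JA JB JC \<and> P \<in> symmedian JB JC JA \<and> P \<in> symmedian JC JA JB"
  and symmedian_point_J_eq: "symmedian_point JA JB JC = K"
proof -
  have "S *\<^sub>R K = (y + z)\<^sup>2 *\<^sub>R JA + (y\<^sup>2 * (1 + z\<^sup>2)) *\<^sub>R JB + (z\<^sup>2 * (1 + y\<^sup>2)) *\<^sub>R JC"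
    using S_pos by (simp add: K_def)
  note * = symmedian_point_eqI[OF det2_J dist_J this[unfolded S_def]]
  show "\<exists>!P. P \<in> symmedian JA JB JC \<and> P \<in> symmedian JB JC JA \<and> P \<in> symmedian JC JA JB"
    by (rule *(1))
  show "symmedian_point JA JB JC = K" by (rule *(2))
qed

end

section \<open>The two hyperbolas in normalized coordinates\<close>

lemma rect_conic_scale:
  assumes "k \<noteq> 0"
  shows "rect_conic (k * \<alpha>) (k * \<beta>) (k * \<gamma>) (k * \<delta>) 0 = rect_conic \<alpha> \<beta> \<gamma> \<delta> 0"
proof -
  have "k * \<alpha> * (u\<^sup>2 - v\<^sup>2) + 2 * (k * \<beta>) * u * v + k * \<gamma> * u + k * \<delta> * v + 0
    = k * (\<alpha> * (u\<^sup>2 - v\<^sup>2) + 2 * \<beta> * u * v + \<gamma> * u + \<delta> * v + 0)" for u v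
    by (simp add: algebra_simps)
  then show ?thesis using assms by (simp add: rect_conic_def)
qed

lemma mem_rect_conic: "P \<in> rect_conic \<alpha> \<beta> \<gamma> \<delta> \<epsilon> \<longleftrightarrow>
    \<alpha> * ((fst P)\<^sup>2 - (snd P)\<^sup>2) + 2 * \<beta> * fst P * snd P + \<gamma> * fst P + \<delta> * snd P + \<epsilon> = 0"
  by (cases P) (simp add: rect_conic_def)

context canonical_triangle
begin

text \<open>The coefficients of the Feuerbach hyperbola (\<open>F\<close>) and of the Jerabek hyperbola of the excentral triangle
  (\<open>J\<close>), scaled to have the same quadratic part.\<close>

definition \<alpha>0 :: real where "\<alpha>0 = 4 * (y - z)"
definition \<beta>0 :: real where "\<beta>0 = - ((y - z)\<^sup>2 + m\<^sup>2 - 4)"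
definition \<gamma>F :: real where "\<gamma>F = 2 * ((y - z)\<^sup>2 - m\<^sup>2 + 4)"
definition \<delta>F :: real where "\<delta>F = 4 * (y - z) * m"
definition \<gamma>J :: real where "\<gamma>J = 2 * (m - 2) * W / m"
definition \<delta>J :: real where "\<delta>J = - 2 * (y - z) * (m - 1) * W / m"

abbreviation "HF \<equiv> rect_conic \<alpha>0 \<beta>0 \<gamma>F \<delta>F 0"
abbreviation "HJ \<equiv> rect_conic \<alpha>0 \<beta>0 \<gamma>J \<delta>J 0"

lemma HF_points: "{A, B, C, 0, H0} \<subseteq> HF"
proof -
  have m: "m \<noteq> 0" using m_pos by simp
  have "A \<in> HF" unfolding mem_rect_conic \<alpha>0_def \<beta>0_def \<gamma>F_def \<delta>F_def A_def fst_conv snd_conv m_def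
    by (insert m, simp add: m_def divide_simps, algebra)
  moreover have "B \<in> HF" unfolding mem_rect_conic \<alpha>0_def \<beta>0_def \<gamma>F_def \<delta>F_def B_def fst_conv snd_conv m_def
    by algebra
  moreover have "C \<in> HF" unfolding mem_rect_conic \<alpha>0_def \<beta>0_def \<gamma>F_def \<delta>F_def C_def fst_conv snd_conv m_def
    by algebra
  moreover have "0 \<in> HF" unfolding mem_rect_conic by simp
  moreover have "H0 \<in> HF" unfolding mem_rect_conic \<alpha>0_def \<beta>0_def \<gamma>F_def \<delta>F_def H0_def fst_conv snd_conv m_def
    by (insert m, simp add: m_def divide_simps, algebra)
  ultimately show ?thesis by simp
qed

text \<open>Among the rectangular conics through \<open>0\<close>, \<open>B\<close>,
  \<open>C\<close> the pair \<open>(\<alpha>, \<beta>)\<close> is free and determines \<gamma> and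
  \<delta>; the vertex \<open>A\<close> then fixes its ratio. Since \<open>y \<noteq> z\<close>
  makes \<open>\<alpha>0\<close> nonzero, the scaling factor can be read off from \<alpha>.\<close>

lemma HF_unique:
  assumes "y \<noteq> z" "\<alpha> \<noteq> 0 \<or> \<beta> \<noteq> 0" and sub: "{A, B, C, 0} \<subseteq> rect_conic \<alpha> \<beta> \<gamma> \<delta> \<epsilon>"
  shows "rect_conic \<alpha> \<beta> \<gamma> \<delta> \<epsilon> = HF"
proof -
  have m: "m \<noteq> 0" using m_pos by simp
  have \<epsilon>: "\<epsilon> = 0" using sub by (simp add: mem_rect_conic)
  have eqs: "\<alpha> * (y\<^sup>2 - 1) + 2 * \<beta> * y - \<gamma> * y - \<delta> = 0" "\<alpha> * (z\<^sup>2 - 1) - 2 * \<beta> * z + \<gamma> * z - \<delta> = 0"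
    using sub by (simp_all add: mem_rect_conic \<epsilon> B_def C_def)
  have "m\<^sup>2 * (\<alpha> * ((fst A)\<^sup>2 - (snd A)\<^sup>2) + 2 * \<beta> * fst A * snd A + \<gamma> * fst A + \<delta> * snd A) =
    \<alpha> * ((y - z)\<^sup>2 - (y * z + 1)\<^sup>2) + 2 * \<beta> * (y - z) * (y * z + 1) + m * (\<gamma> * (y - z) + \<delta> * (y * z + 1))"
    using m unfolding A_def fst_conv snd_conv by (simp add: divide_simps) algebra
  then have eqA: "\<alpha> * ((y - z)\<^sup>2 - (y * z + 1)\<^sup>2) + 2 * \<beta> * (y - z) * (y * z + 1)
      + m * (\<gamma> * (y - z) + \<delta> * (y * z + 1)) = 0"
    using sub by (simp add: mem_rect_conic \<epsilon>)
  have "(y + z) * (\<gamma> - (\<alpha> * (y - z) + 2 * \<beta>)) = 0" using eqs by algebra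
  then have \<gamma>: "\<gamma> = \<alpha> * (y - z) + 2 * \<beta>" using y_pos z_pos by simp
  then have \<delta>: "\<delta> = \<alpha> * m" using eqs(1) unfolding m_def by algebra
  have "y * z * (\<beta> * \<alpha>0 - \<alpha> * \<beta>0) = 0"
    using eqA unfolding \<gamma> \<delta> \<alpha>0_def \<beta>0_def m_def by algebra
  then have eq: "\<beta> * \<alpha>0 = \<alpha> * \<beta>0" using y_pos z_pos by simp
  define k where "k = \<alpha> / \<alpha>0"
  have "\<alpha>0 \<noteq> 0" using assms(1) by (simp add: \<alpha>0_def)
  then have k: "\<alpha> = k * \<alpha>0" "\<beta> = k * \<beta>0" using eq by (simp_all add: k_def field_simps)
  have "\<gamma> = k * \<gamma>F" "\<delta> = k * \<delta>F"
    unfolding \<gamma> \<delta> k \<alpha>0_def \<beta>0_def \<gamma>F_def \<delta>F_def by algebra+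
  moreover have "k \<noteq> 0" using assms(2) k by auto
  ultimately show ?thesis unfolding k \<epsilon> by (simp add: rect_conic_scale)
qed

lemma HJ_points: "{JA, JB, JC, V, 0, K} \<subseteq> HJ"
proof -
  have m: "m \<noteq> 0" using m_pos by simp
  have S: "S \<noteq> 0" using S_pos by simp
  have "JA \<in> HJ" unfolding mem_rect_conic \<alpha>0_def \<beta>0_def \<gamma>J_def \<delta>J_def JA_def fst_conv snd_conv W_def m_def
    by (insert m, simp add: m_def divide_simps, algebra)
  moreover have "JB \<in> HJ" unfolding mem_rect_conic \<alpha>0_def \<beta>0_def \<gamma>J_def \<delta>J_def JB_def fst_conv snd_conv W_def m_def
    by (insert m, simp add: m_def divide_simps, algebra)
  moreover have "JC \<in> HJ" unfolding mem_rect_conic \<alpha>0_def \<beta>0_def \<gamma>J_def \<delta>J_def JC_def fst_conv snd_conv W_def m_def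
    by (insert m, simp add: m_def divide_simps, algebra)
  moreover have "V \<in> HJ" unfolding mem_rect_conic \<alpha>0_def \<beta>0_def \<gamma>J_def \<delta>J_def V_def fst_conv snd_conv W_def m_def
    by (insert m, simp add: m_def divide_simps, algebra)
  moreover have "0 \<in> HJ" unfolding mem_rect_conic by simp
  moreover have "K \<in> HJ"
  proof -
    \<comment> \<open>\<open>k1\<close> and \<open>k2\<close> are the numerators of \<open>K\<close>
      over the denominator \<open>m * S\<close>. With \<open>t\<close> for its inverse, every term
      of the equation contains \<open>t\<^sup>2\<close>, and one polynomial identity
      remains.\<close>
    define k1 where "k1 = (y + z)\<^sup>2 * (z - y) * m + y ^ 3 * (1 + z\<^sup>2)\<^sup>2 - z ^ 3 * (1 + y\<^sup>2)\<^sup>2"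
    define k2 where "k2 = - (y + z)\<^sup>2 * (y * z + 1) * m + y\<^sup>2 * (1 + z\<^sup>2)\<^sup>2 + z\<^sup>2 * (1 + y\<^sup>2)\<^sup>2"
    define t where "t = 1 / (m * S)"
    have K: "K = (k1 * t, k2 * t)"
      unfolding K_def JA_def JB_def JC_def k1_def k2_def t_def using m S
      by (simp add: divide_simps) (simp add: power2_eq_square power3_eq_cube algebra_simps)
    have J: "\<gamma>J = 2 * (m - 2) * W * (S * t)" "\<delta>J = - 2 * (y - z) * (m - 1) * W * (S * t)"
      unfolding \<gamma>J_def \<delta>J_def t_def using m S by simp_all
    have "\<alpha>0 * (k1\<^sup>2 - k2\<^sup>2) + 2 * \<beta>0 * k1 * k2 + (2 * (m - 2) * W * k1 - 2 * (y - z) * (m - 1) * W * k2) * S = 0"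
      unfolding \<alpha>0_def \<beta>0_def k1_def k2_def W_def m_def S_def by algebra
    then show ?thesis unfolding mem_rect_conic K J fst_conv snd_conv by algebra
  qed
  ultimately show ?thesis by simp
qed

text \<open>\<open>0\<close>, \<open>JA\<close>, \<open>JB\<close>, \<open>JC\<close> form an
  orthocentric system, and a rectangular conic through three of these points contains the fourth.
  The condition fixing the ratio of \<alpha> and \<beta> therefore comes from the circumcenter
  \<open>V\<close>.\<close>

lemma HJ_unique:
  assumes "y \<noteq> z" "\<alpha> \<noteq> 0 \<or> \<beta> \<noteq> 0" and sub: "{JB, JC, V, 0} \<subseteq> rect_conic \<alpha> \<beta> \<gamma> \<delta> \<epsilon>"
  shows "rect_conic \<alpha> \<beta> \<gamma> \<delta> \<epsilon> = HJ"
proof -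
  have m: "m \<noteq> 0" using m_pos by simp
  have \<epsilon>: "\<epsilon> = 0" using sub by (simp add: mem_rect_conic)
  \<comment> \<open>\<open>JB\<close> is \<open>(1 + z\<^sup>2) / m\<close> times
    \<open>(y, 1)\<close>, so a factor \<open>1 + z\<^sup>2\<close> can be cancelled; similarly for
    \<open>JC\<close>.\<close>
  have "(1 + z\<^sup>2) * ((\<alpha> * (y\<^sup>2 - 1) + 2 * \<beta> * y) * (1 + z\<^sup>2) + m * (\<gamma> * y + \<delta>))
    = m\<^sup>2 * (\<alpha> * ((fst JB)\<^sup>2 - (snd JB)\<^sup>2) + 2 * \<beta> * fst JB * snd JB + \<gamma> * fst JB + \<delta> * snd JB)"
    using m unfolding JB_def fst_conv snd_conv by (simp add: divide_simps) algebra
  also have "\<dots> = 0" using sub by (simp add: mem_rect_conic \<epsilon>)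
  finally have eqB: "(\<alpha> * (y\<^sup>2 - 1) + 2 * \<beta> * y) * (1 + z\<^sup>2) + m * (\<gamma> * y + \<delta>) = 0"
    using y2z2_pos by simp
  have "(1 + y\<^sup>2) * ((\<alpha> * (z\<^sup>2 - 1) - 2 * \<beta> * z) * (1 + y\<^sup>2) + m * (\<delta> - \<gamma> * z))
    = m\<^sup>2 * (\<alpha> * ((fst JC)\<^sup>2 - (snd JC)\<^sup>2) + 2 * \<beta> * fst JC * snd JC + \<gamma> * fst JC + \<delta> * snd JC)"
    using m unfolding JC_def fst_conv snd_conv by (simp add: divide_simps) algebra
  also have "\<dots> = 0" using sub by (simp add: mem_rect_conic \<epsilon>)
  finally have eqC: "(\<alpha> * (z\<^sup>2 - 1) - 2 * \<beta> * z) * (1 + y\<^sup>2) + m * (\<delta> - \<gamma> * z) = 0"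
    using y2z2_pos by simp
  have "(y + z) * (m * \<gamma> - (- 2 * \<alpha> * (y - z) - 2 * \<beta> * (1 + y * z))) = 0" using eqB eqC by algebra
  then have \<gamma>: "m * \<gamma> = - 2 * \<alpha> * (y - z) - 2 * \<beta> * (1 + y * z)" using y_pos z_pos by simp
  have "(y + z) * (m * \<delta> - (- \<alpha> * ((y * z)\<^sup>2 - 1 - (y - z)\<^sup>2) + 2 * \<beta> * y * z * (y - z))) = 0"
    using eqB eqC by algebra
  then have \<delta>: "m * \<delta> = - \<alpha> * ((y * z)\<^sup>2 - 1 - (y - z)\<^sup>2) + 2 * \<beta> * y * z * (y - z)"
    using y_pos z_pos by simp
  \<comment> \<open>The second coordinate of \<open>V\<close> stays a symbol, tied to
    \<open>W\<close> by \<open>vm\<close>, which keeps the elimination polynomial.\<close>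
  have V2: "snd V = W / (2 * m) - m - 2" by (simp add: V_def)
  then have vm: "2 * m * (snd V + m + 2) = W" using m by simp
  have "\<alpha> * ((z - y)\<^sup>2 - (snd V)\<^sup>2) + 2 * \<beta> * (z - y) * snd V + \<gamma> * (z - y) + \<delta> * snd V = 0"
    using sub by (simp add: mem_rect_conic \<epsilon> V_def)
  then have "4 * m * (\<alpha> * m * ((y - z)\<^sup>2 - (snd V)\<^sup>2) - 2 * \<beta> * m * (y - z) * snd V
      - (m * \<gamma>) * (y - z) + (m * \<delta>) * snd V) = 0"
    by algebra
  then have "W * (\<beta> * \<alpha>0 - \<alpha> * \<beta>0) = 0"
    using vm unfolding \<gamma> \<delta> unfolding W_def \<alpha>0_def \<beta>0_def m_def by algebra
  then have eq: "\<beta> * \<alpha>0 = \<alpha> * \<beta>0" using W_pos by simp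
  define k where "k = \<alpha> / \<alpha>0"
  have "\<alpha>0 \<noteq> 0" using assms(1) by (simp add: \<alpha>0_def)
  then have k: "\<alpha> = k * \<alpha>0" "\<beta> = k * \<beta>0" using eq by (simp_all add: k_def field_simps)
  have "m * \<gamma> = k * (2 * (m - 2) * W)" "m * \<delta> = k * (- 2 * (y - z) * (m - 1) * W)"
    unfolding \<gamma> \<delta> unfolding k \<alpha>0_def \<beta>0_def m_def W_def by algebra+
  then have "\<gamma> = k * \<gamma>J" "\<delta> = k * \<delta>J"
    unfolding \<gamma>J_def \<delta>J_def using m by (simp_all add: field_simps)
  moreover have "k \<noteq> 0" using assms(2) k by auto
  ultimately show ?thesis unfolding k \<epsilon> by (simp add: rect_conic_scale)
qed

section \<open>Nondegeneracy and the ratio of the focal lengths\<close>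

definition kF :: real where "kF = \<alpha>0 * (\<gamma>F\<^sup>2 - \<delta>F\<^sup>2) + 2 * \<beta>0 * \<gamma>F * \<delta>F"

text \<open>With the third tangent length \<open>x = (y + z) / m\<close> the long factors are
  \<open>m * (x - y)\<close> and \<open>m * (x - z)\<close>. So \<open>kF\<close> vanishes exactly
  for isosceles triangles.\<close>

lemma kF_factor: "kF = 16 * (y - z) * (y + z - y * m) * (y + z - z * m) * W"
  unfolding kF_def \<alpha>0_def \<beta>0_def \<gamma>F_def \<delta>F_def W_def m_def by algebra

text \<open>As both conics share \<open>\<alpha>0\<close> and \<open>\<beta>0\<close>, the squared
  ratio of the focal lengths is the quotient of these invariants, here twice the
  circumradius.\<close>

lemma kJ_eq: "\<alpha>0 * (\<gamma>J\<^sup>2 - \<delta>J\<^sup>2) + 2 * \<beta>0 * \<gamma>J * \<delta>J = W / (2 * m) * kF"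
proof -
  have m: "m \<noteq> 0" using m_pos by simp
  define X where "X = 2 * (m - 2) * W"
  define Y where "Y = - 2 * (y - z) * (m - 1) * W"
  have "2 * (\<alpha>0 * (X\<^sup>2 - Y\<^sup>2) + 2 * \<beta>0 * X * Y) = m * W * kF"
    unfolding kF_factor \<alpha>0_def \<beta>0_def X_def Y_def W_def m_def by algebra
  moreover have "2 * m\<^sup>2 * (\<alpha>0 * ((X / m)\<^sup>2 - (Y / m)\<^sup>2) + 2 * \<beta>0 * (X / m) * (Y / m))
      = 2 * (\<alpha>0 * (X\<^sup>2 - Y\<^sup>2) + 2 * \<beta>0 * X * Y)"
    using m by (simp add: field_simps power2_eq_square)
  ultimately have "2 * m\<^sup>2 * (\<alpha>0 * (\<gamma>J\<^sup>2 - \<delta>J\<^sup>2) + 2 * \<beta>0 * \<gamma>J * \<delta>J) = 2 * m\<^sup>2 * (W / (2 * m) * kF)"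
    unfolding \<gamma>J_def \<delta>J_def X_def[symmetric] Y_def[symmetric] using m by (simp add: power2_eq_square)
  moreover have "2 * m\<^sup>2 \<noteq> 0" using m by simp
  ultimately show ?thesis by (metis mult_left_cancel)
qed

end

locale scalene_canonical_triangle = canonical_triangle +
  assumes scalene: "scalene A B C"
begin

lemma y_neq_z: "y \<noteq> z" and kF_nonzero: "kF \<noteq> 0"
proof -
  have m: "m \<noteq> 0" using m_pos by simp
  have s: "y + z \<noteq> y * (1 + z\<^sup>2) / m" "y * (1 + z\<^sup>2) / m \<noteq> z * (1 + y\<^sup>2) / m" "z * (1 + y\<^sup>2) / m \<noteq> y + z"
    using scalene unfolding scalene_def side_dists by auto
  show "y \<noteq> z" using s(2) by auto
  have "y + z \<noteq> z * m"
  proof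
    assume "y + z = z * m"
    then have "(y + z) * m = z * (1 + y\<^sup>2)" unfolding m_def by algebra
    then show False using s(3) m by (simp add: field_simps)
  qed
  moreover have "y + z \<noteq> y * m"
  proof
    assume "y + z = y * m"
    then have "(y + z) * m = y * (1 + z\<^sup>2)" unfolding m_def by algebra
    then show False using s(1) m by (simp add: field_simps)
  qed
  ultimately show "kF \<noteq> 0" using \<open>y \<noteq> z\<close> W_pos by (simp add: kF_factor)
qed

lemma kJ_nonzero: "\<alpha>0 * (\<gamma>J\<^sup>2 - \<delta>J\<^sup>2) + 2 * \<beta>0 * \<gamma>J * \<delta>J \<noteq> 0"
  unfolding kJ_eq using kF_nonzero W_pos m_pos by simp

lemma HF_rectangular: "rectangular_hyperbola HF"
  and HJ_rectangular: "rectangular_hyperbola HJ"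
  using rect_conic_hyperbola(1)[OF kF_nonzero[unfolded kF_def]] rect_conic_hyperbola(1)[OF kJ_nonzero]
  by simp_all

lemma focal_length_HF_pos: "0 < focal_length HF"
proof -
  have "0 < \<alpha>0\<^sup>2 + \<beta>0\<^sup>2" using y_neq_z by (intro add_pos_nonneg) (simp_all add: \<alpha>0_def)
  then show ?thesis
    using rect_conic_hyperbola(2)[OF kF_nonzero[unfolded kF_def]] kF_nonzero by (simp add: kF_def)
qed

lemma focal_length_HJ: "focal_length HJ = sqrt (W / (2 * m)) * focal_length HF"
proof -
  have "focal_length HJ = sqrt (2 * \<bar>W / (2 * m) * kF\<bar> / ((\<alpha>0\<^sup>2 + \<beta>0\<^sup>2) * sqrt (\<alpha>0\<^sup>2 + \<beta>0\<^sup>2)))"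
    using rect_conic_hyperbola(2)[OF kJ_nonzero] by (simp add: kJ_eq)
  also have "2 * \<bar>W / (2 * m) * kF\<bar> = W / (2 * m) * (2 * \<bar>kF\<bar>)"
    using W_pos m_pos by (simp add: abs_mult)
  also have "sqrt (W / (2 * m) * (2 * \<bar>kF\<bar>) / ((\<alpha>0\<^sup>2 + \<beta>0\<^sup>2) * sqrt (\<alpha>0\<^sup>2 + \<beta>0\<^sup>2)))
    = sqrt (W / (2 * m)) * sqrt (2 * \<bar>kF\<bar> / ((\<alpha>0\<^sup>2 + \<beta>0\<^sup>2) * sqrt (\<alpha>0\<^sup>2 + \<beta>0\<^sup>2)))"
    unfolding real_sqrt_mult[symmetric] times_divide_eq_right ..
  finally show ?thesis
    using rect_conic_hyperbola(2)[OF kF_nonzero[unfolded kF_def]] by (simp add: kF_def)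
qed

lemma Feuerbach_iff:
  "rectangular_hyperbola H \<and> {A, B, C, 0, H0} \<subseteq> H \<longleftrightarrow> H = HF"
proof
  assume H: "rectangular_hyperbola H \<and> {A, B, C, 0, H0} \<subseteq> H"
  then have "rectangular_hyperbola H" by simp
  then obtain \<alpha> \<beta> \<gamma> \<delta> \<epsilon> where "\<alpha> \<noteq> 0 \<or> \<beta> \<noteq> 0" "H = rect_conic \<alpha> \<beta> \<gamma> \<delta> \<epsilon>"
    by (rule rectangular_hyperbola_conic)
  then show "H = HF" using HF_unique[OF y_neq_z] H by simp
next
  assume "H = HF"
  then show "rectangular_hyperbola H \<and> {A, B, C, 0, H0} \<subseteq> H"
    using HF_rectangular HF_points by blast
qed

lemma Jerabek_iff:
  "rectangular_hyperbola H \<and> {JA, JB, JC, V, 0, K} \<subseteq> H \<longleftrightarrow> H = HJ"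
proof
  assume H: "rectangular_hyperbola H \<and> {JA, JB, JC, V, 0, K} \<subseteq> H"
  then have "rectangular_hyperbola H" by simp
  then obtain \<alpha> \<beta> \<gamma> \<delta> \<epsilon> where "\<alpha> \<noteq> 0 \<or> \<beta> \<noteq> 0" "H = rect_conic \<alpha> \<beta> \<gamma> \<delta> \<epsilon>"
    by (rule rectangular_hyperbola_conic)
  then show "H = HJ" using HJ_unique[OF y_neq_z] H by simp
next
  assume "H = HJ"
  then show "rectangular_hyperbola H \<and> {JA, JB, JC, V, 0, K} \<subseteq> H"
    using HJ_rectangular HJ_points by blast
qed

end

section \<open>Every triangle is similar to a normalized one\<close>

lemma triangle_det2: "triangle A B C \<Longrightarrow> det2 (C - B) (A - B) \<noteq> 0"
proof
  assume "triangle A B C" and d: "det2 (C - B) (A - B) = 0"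
  have "(norm (C - B))\<^sup>2 *\<^sub>R (A - B) = ((A - B) \<bullet> (C - B)) *\<^sub>R (C - B)"
    using d unfolding power2_norm_eq_inner
    by (simp add: det2_def inner_prod_def prod_eq_iff) algebra
  moreover have "C - B \<noteq> 0"
  proof
    assume "C - B = 0"
    then have "collinear {A, B, C}" by (simp add: insert_commute)
    then show False using \<open>triangle A B C\<close> by (simp add: triangle_def)
  qed
  ultimately have "A - B = (((A - B) \<bullet> (C - B)) / (norm (C - B))\<^sup>2) *\<^sub>R (C - B)"
    by (metis (no_types, lifting) divide_inverse_commute eq_vector_fraction_iff power_not_zero norm_eq_zero scaleR_scaleR)
  then have "collinear {0, C - B, A - B}" unfolding collinear_lemma by blast
  then have "collinear {C, B, A}" by (simp add: collinear_3)
  then show False using \<open>triangle A B C\<close> by (simp add: triangle_def insert_commute)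
qed

lemma similar_canonical_triangle:
  assumes "triangle A B C"
  obtains \<phi> Z L r y z where "similarity \<phi> Z L r" "canonical_triangle y z"
    "A = \<phi> (canonical_triangle.A y z)" "B = \<phi> (canonical_triangle.B y)" "C = \<phi> (canonical_triangle.C z)"
proof -
  define a where "a = norm (C - B)"
  \<comment> \<open>The sign turns \<open>w\<close> to the side of \<open>A\<close> for either
    orientation of the triangle, so that the height \<open>h\<close> is positive.\<close>
  define \<sigma> where "\<sigma> = sgn (det2 (C - B) (A - B))"
  define u where "u = (C - B) /\<^sub>R a"
  define w where "w = \<sigma> *\<^sub>R (- snd u, fst u)"
  define g where "g = (A - B) \<bullet> u"
  define h where "h = (A - B) \<bullet> w"
  have d: "det2 (C - B) (A - B) \<noteq> 0" by (rule triangle_det2[OF assms])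
  then have "C - B \<noteq> 0" by (auto simp: det2_def)
  then have "a > 0" by (simp add: a_def)
  have CB: "C - B = a *\<^sub>R u" using \<open>a > 0\<close> by (simp add: u_def)
  have "norm u = 1" using \<open>a > 0\<close> by (simp add: u_def a_def)
  then have uu: "(fst u)\<^sup>2 + (snd u)\<^sup>2 = 1" by (simp add: norm_prod_def)
  have \<sigma>2: "\<sigma>\<^sup>2 = 1" using d by (simp add: \<sigma>_def sgn_if)
  have ww: "(fst w)\<^sup>2 + (snd w)\<^sup>2 = 1" using uu \<sigma>2 unfolding w_def by simp algebra
  have uw: "fst u * fst w + snd u * snd w = 0" by (simp add: w_def)
  have "a * h = \<sigma> * det2 (C - B) (A - B)"
    unfolding CB by (simp add: h_def w_def det2_def inner_prod_def algebra_simps)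
  also have "\<dots> > 0" using d by (simp add: \<sigma>_def sgn_if)
  finally have "h > 0" using \<open>a > 0\<close> by (simp add: zero_less_mult_iff)
  have AB: "A - B = g *\<^sub>R u + h *\<^sub>R w"
    using uu \<sigma>2 unfolding g_def h_def w_def
    by (simp add: prod_eq_iff inner_prod_def) (intro conjI; algebra)
  define c where "c = sqrt (g\<^sup>2 + h\<^sup>2)"
  define b where "b = sqrt ((a - g)\<^sup>2 + h\<^sup>2)"
  have c2: "c\<^sup>2 = g\<^sup>2 + h\<^sup>2" and b2: "b\<^sup>2 = (a - g)\<^sup>2 + h\<^sup>2" by (simp_all add: c_def b_def)
  have cg: "\<bar>g\<bar> < c" unfolding c_def using \<open>h > 0\<close> by (intro real_less_rsqrt) simp
  have bg: "\<bar>a - g\<bar> < b" unfolding b_def using \<open>h > 0\<close> by (intro real_less_rsqrt) simp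
  \<comment> \<open>The cotangent of a half angle is \<open>(1 + cos) / sin\<close>; at
    \<open>B\<close> cosine and sine are \<open>g / c\<close> and \<open>h / c\<close>, at
    \<open>C\<close> they are \<open>(a - g) / b\<close> and \<open>h / b\<close>.\<close>
  define y where "y = (c + g) / h"
  define z where "z = (b + (a - g)) / h"
  have "y > 0" "z > 0" using cg bg \<open>h > 0\<close> by (auto simp: y_def z_def)
  have yh: "y * h = c + g" and zh: "z * h = b + (a - g)" using \<open>h > 0\<close> by (simp_all add: y_def z_def)
  have "h * (2 * y * g) = h * (h * (y\<^sup>2 - 1))" using yh c2 by algebra
  then have yg: "2 * y * g = h * (y\<^sup>2 - 1)" using \<open>h > 0\<close> by simp
  have "h * (2 * z * (a - g)) = h * (h * (z\<^sup>2 - 1))" using zh b2 by algebra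
  then have zg: "2 * z * (a - g) = h * (z\<^sup>2 - 1)" using \<open>h > 0\<close> by simp
  have ah: "2 * y * z * a = h * (y + z) * (y * z - 1)" using yg zg by algebra
  have "0 < h * (y + z) * (y * z - 1)" unfolding ah[symmetric] using \<open>y > 0\<close> \<open>z > 0\<close> \<open>a > 0\<close> by simp
  then have m: "0 < y * z - 1"
    using zero_less_mult_pos[of "h * (y + z)" "y * z - 1"] \<open>y > 0\<close> \<open>z > 0\<close> \<open>h > 0\<close> by simp
  interpret canonical_triangle y z
    using \<open>y > 0\<close> \<open>z > 0\<close> m by unfold_locales auto
  \<comment> \<open>The tangent lengths \<open>r * y\<close> and \<open>r * z\<close> fill the side
    \<open>a\<close>, which determines the inradius.\<close>
  define r where "r = a / (y + z)"
  have "r > 0" using \<open>a > 0\<close> \<open>y > 0\<close> \<open>z > 0\<close> by (simp add: r_def)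
  have ra: "r * (y + z) = a" using \<open>y > 0\<close> \<open>z > 0\<close> by (simp add: r_def)
  have "(y + z) * (2 * y * z * r) = (y + z) * (h * m)" using ah ra unfolding m_def by algebra
  then have rh: "2 * y * z * r = h * m" using \<open>y > 0\<close> \<open>z > 0\<close> by simp
  define L where "L p = (r * fst p) *\<^sub>R u + (r * snd p) *\<^sub>R w" for p :: point
  \<comment> \<open>This is the incenter: it lies at height \<open>r\<close> above the touching
    point, which is at distance \<open>r * y\<close> from \<open>B\<close>.\<close>
  define Z where "Z = B + (r * y) *\<^sub>R u + r *\<^sub>R w"
  define \<phi> where "\<phi> p = Z + L p" for p
  have "linear L"
    by (rule linearI) (simp_all add: L_def algebra_simps)
  moreover have "norm (L v) = r * norm v" for v
  proof -
    have "(norm (L v))\<^sup>2 = (r * norm v)\<^sup>2"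
      using uu ww uw unfolding power_mult_distrib power2_norm_eq_inner
      by (simp add: L_def inner_prod_def) algebra
    then show ?thesis using \<open>r > 0\<close> by (simp add: power2_eq_iff_nonneg)
  qed
  ultimately have "similarity \<phi> Z L r"
    using \<open>r > 0\<close> by (intro similarity.intro) (simp_all add: \<phi>_def)
  moreover have "B = \<phi> local.B"
    by (simp add: \<phi>_def Z_def L_def B_def algebra_simps)
  moreover have "C = \<phi> local.C"
  proof -
    have "\<phi> local.C = B + (r * (y + z)) *\<^sub>R u"
      by (simp add: \<phi>_def Z_def L_def C_def algebra_simps)
    then show ?thesis using CB unfolding ra by (simp add: diff_eq_eq add.commute)
  qed
  moreover have "A = \<phi> local.A"
  proof -
    have mnz: "m \<noteq> 0" using m_pos by simp
    have "2 * y * (m * (r * y + r * ((y - z) / m))) = 2 * y * (m * g)"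
    proof -
      have "2 * y * (m * (r * y + r * ((y - z) / m))) = 2 * y * r * (m * y + (y - z))"
        using mnz by (simp add: field_simps)
      also have "\<dots> = m * (2 * y * g)" using rh unfolding yg unfolding m_def by algebra
      finally show ?thesis by simp
    qed
    then have 1: "r * y + r * ((y - z) / m) = g" using mnz \<open>y > 0\<close> by simp
    have "m * (r + r * ((y * z + 1) / m)) = 2 * y * z * r"
      using mnz by (simp add: field_simps) (simp add: m_def algebra_simps)
    then have 2: "r + r * ((y * z + 1) / m) = h" using rh mnz by simp
    have "\<phi> local.A = B + (r * y + r * ((y - z) / m)) *\<^sub>R u + (r + r * ((y * z + 1) / m)) *\<^sub>R w"
      by (simp add: \<phi>_def Z_def L_def A_def scaleR_add_left)
    then show ?thesis unfolding 1 2 using AB by (simp add: algebra_simps)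
  qed
  ultimately show ?thesis using that canonical_triangle_axioms by blast
qed

section \<open>The billiard\<close>

locale similar_scalene_triangle = similarity \<phi> Z L r + scalene_canonical_triangle y z
  for \<phi> Z L r y z
begin

section \<open>Centers, radii and hyperbolas of the similar copy\<close>

lemma incenter_\<phi>: "incenter (\<phi> A) (\<phi> B) (\<phi> C) = \<phi> 0"
  by (subst incenter_image) (simp_all add: incenter_unique incenter_eq)

lemma inradius_\<phi>: "inradius (\<phi> A) (\<phi> B) (\<phi> C) = r"
proof -
  have "inradius (\<phi> A) (\<phi> B) (\<phi> C) = infdist (\<phi> (incenter A B C)) (\<phi> ` (affine hull {B, C}))"
    using affine_hull_image[of "{B, C}"] by (simp add: inradius_def incenter_\<phi> incenter_eq)
  also have "\<dots> = r * inradius A B C"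
    unfolding inradius_def by (rule infdist_image) simp
  finally show ?thesis by (simp add: inradius_eq)
qed

lemma circumradius_\<phi>: "circumradius (\<phi> A) (\<phi> B) (\<phi> C) = r * (W / (4 * m))"
  using circumradius_eq unfolding circumradius_def
  by (simp add: circumcenter_image[OF circumcenter_unique] dist_\<phi>)

lemma orthocenter_\<phi>: "orthocenter (\<phi> A) (\<phi> B) (\<phi> C) = \<phi> H0"
  by (simp add: orthocenter_image[OF orthocenter_unique] orthocenter_eq)

lemma excenter_\<phi>:
  "excenter (\<phi> A) (\<phi> B) (\<phi> C) = \<phi> JA"
  "excenter (\<phi> B) (\<phi> C) (\<phi> A) = \<phi> JB"
  "excenter (\<phi> C) (\<phi> A) (\<phi> B) = \<phi> JC"
proof -
  show "excenter (\<phi> A) (\<phi> B) (\<phi> C) = \<phi> JA"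
    by (subst excenter_image) (simp_all add: excenter_A_unique excenter_eq)
  show "excenter (\<phi> B) (\<phi> C) (\<phi> A) = \<phi> JB"
    by (subst excenter_image) (simp_all add: excenter_B_unique excenter_eq)
  show "excenter (\<phi> C) (\<phi> A) (\<phi> B) = \<phi> JC"
    by (subst excenter_image) (simp_all add: excenter_C_unique excenter_eq)
qed

lemma Feuerbach_hyperbola_\<phi>: "Feuerbach_hyperbola (\<phi> A) (\<phi> B) (\<phi> C) = \<phi> ` HF"
proof -
  have "Feuerbach_hyperbola (\<phi> A) (\<phi> B) (\<phi> C) =
      \<phi> ` (THE H. rectangular_hyperbola H \<and> {A, B, C, 0, H0} \<subseteq> H)"
    unfolding Feuerbach_hyperbola_def
  proof (rule the_image_set)
    show "\<exists>!H. rectangular_hyperbola H \<and> {A, B, C, 0, H0} \<subseteq> H"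
      unfolding Feuerbach_iff by simp
  qed (simp add: incenter_\<phi> orthocenter_\<phi> rectangular_hyperbola_image)
  then show ?thesis unfolding Feuerbach_iff by simp
qed

lemma excentral_Jerabek_hyperbola_\<phi>:
  "excentral_Jerabek_hyperbola (\<phi> A) (\<phi> B) (\<phi> C) = \<phi> ` HJ"
proof -
  have "Jerabek_hyperbola (\<phi> JA) (\<phi> JB) (\<phi> JC) =
      \<phi> ` (THE H. rectangular_hyperbola H \<and> {JA, JB, JC, V, 0, K} \<subseteq> H)"
    unfolding Jerabek_hyperbola_def
  proof (rule the_image_set)
    show "\<exists>!H. rectangular_hyperbola H \<and> {JA, JB, JC, V, 0, K} \<subseteq> H"
      unfolding Jerabek_iff by simp
  qed (simp add: circumcenter_image[OF circumcenter_J_unique] orthocenter_image[OF orthocenter_J_unique]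
      symmedian_point_image[OF symmedian_point_J_unique] circumcenter_J_eq orthocenter_J_eq
      symmedian_point_J_eq rectangular_hyperbola_image)
  then show ?thesis unfolding Jerabek_iff excentral_Jerabek_hyperbola_def excenter_\<phi> by simp
qed

lemma radius_ratio: "inradius (\<phi> A) (\<phi> B) (\<phi> C) / circumradius (\<phi> A) (\<phi> B) (\<phi> C) = 4 / (W / m)"
  unfolding inradius_\<phi> circumradius_\<phi> using r_pos by simp

lemma focal_length_ratio:
  "focal_length (excentral_Jerabek_hyperbola (\<phi> A) (\<phi> B) (\<phi> C))
    / focal_length (Feuerbach_hyperbola (\<phi> A) (\<phi> B) (\<phi> C)) = sqrt (W / m / 2)"
  unfolding Feuerbach_hyperbola_\<phi> excentral_Jerabek_hyperbola_\<phi>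
    focal_length_image[OF HF_rectangular] focal_length_image[OF HJ_rectangular] focal_length_HJ
  using r_pos focal_length_HF_pos by (simp add: mult.commute)

text \<open>\<open>W / m\<close> is four times the quotient of circumradius and inradius, so this is
  Euler's inequality; \<open>y \<noteq> z\<close> makes it strict.\<close>

lemma Euler_inequality: "8 < W / m"
proof -
  have "W - 8 * m = (y - z)\<^sup>2 + (m - 2)\<^sup>2" unfolding W_eq by algebra
  also have "\<dots> > 0" using y_neq_z by (intro add_pos_nonneg) simp_all
  finally show ?thesis using m_pos by (simp add: field_simps)
qed

lemma det2_L: "det2 (L (1, 0)) (L (0, 1)) \<noteq> 0"
proof
  let ?e = "L (1, 0)" and ?f = "L (0, 1)"
  assume "det2 ?e ?f = 0"
  moreover have "(?e \<bullet> ?e) * (?f \<bullet> ?f) = (?e \<bullet> ?f)\<^sup>2 + (det2 ?e ?f)\<^sup>2"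
    unfolding det2_def inner_prod_def inner_real_def by algebra
  ultimately show False using r_pos by (simp add: inner_L)
qed

text \<open>The gradient \<open>D P\<close> of the ellipse at each vertex is a multiple of the vector from the incenter to the
  vertex. Since \<open>(D P + D Q) \<bullet> (P - Q) = 0\<close> for points \<open>P\<close>, \<open>Q\<close> of the ellipse, the factors of
  proportionality are inverse to the tangent lengths. This determines the linear map \<open>D\<close> in the
  basis \<open>L (1, 0)\<close>, \<open>L (0, 1)\<close> up to a factor; comparing trace and determinant gives the relation.\<close>

lemma billiard_relation:
  assumes "billiard_3_periodic a b (\<phi> A) (\<phi> B) (\<phi> C)" "a > 0" "b > 0"
  shows "(a\<^sup>2 + b\<^sup>2)\<^sup>2 * (4 * (W / m + 1)) = a\<^sup>2 * b\<^sup>2 * (W / m + 4)\<^sup>2"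
proof -
  define D where "D P = (fst P / a\<^sup>2, snd P / b\<^sup>2)" for P :: point
  have D_lin: "D (P + Q) = D P + D Q" "D (P - Q) = D P - D Q" "D (t *\<^sub>R P) = t *\<^sub>R D P" for P Q t
    by (simp_all add: D_def add_divide_distrib diff_divide_distrib)
  have on: "P \<bullet> D P = 1" if "P \<in> ellipse a b" for P
    using that by (auto simp: ellipse_def D_def inner_prod_def power2_eq_square)
  have normal: "\<exists>c. D (\<phi> X) = c *\<^sub>R L X"
    if "ellipse_normal a b (\<phi> X) = \<phi> ` {P. det2 P X = 0}" "X \<noteq> 0" for X
  proof -
    \<comment> \<open>The normal coincides with the internal bisector and hence contains the
      incenter \<open>\<phi> 0\<close>.\<close>
    have "\<phi> 0 \<in> ellipse_normal a b (\<phi> X)" unfolding that(1) by (simp add: det2_def)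
    then obtain t where t: "\<phi> 0 = \<phi> X + t *\<^sub>R D (\<phi> X)"
      by (auto simp: ellipse_normal_def line_along_def D_def)
    then have tD: "t *\<^sub>R D (\<phi> X) = - L X" by (simp add: \<phi>_eq linear_0[OF linear] algebra_simps add_eq_0_iff)
    have "t \<noteq> 0" using t that(2) by auto
    then have "D (\<phi> X) = (- 1 / t) *\<^sub>R L X" using arg_cong[OF tD, of "\<lambda>v. (1 / t) *\<^sub>R v"] by simp
    then show ?thesis by blast
  qed
  have bil: "\<phi> A \<in> ellipse a b" "\<phi> B \<in> ellipse a b" "\<phi> C \<in> ellipse a b"
    "ellipse_normal a b (\<phi> A) = \<phi> ` {P. det2 P A = 0}"
    "ellipse_normal a b (\<phi> B) = \<phi> ` {P. det2 P B = 0}"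
    "ellipse_normal a b (\<phi> C) = \<phi> ` {P. det2 P C = 0}"
    using assms(1) by (auto simp: billiard_3_periodic_def internal_bisector_image bisectors)
  obtain \<tau>A \<tau>B \<tau>C where DA: "D (\<phi> A) = \<tau>A *\<^sub>R L A" and DB: "D (\<phi> B) = \<tau>B *\<^sub>R L B"
    and DC: "D (\<phi> C) = \<tau>C *\<^sub>R L C"
    using normal bil vertices_nonzero by metis
  have mnz [simp]: "m \<noteq> 0" using m_pos by simp
  have ynz: "y \<noteq> 0" "z \<noteq> 0" "y + z \<noteq> 0" using y_pos z_pos by auto
  have chord: "(\<tau> *\<^sub>R X + \<mu> *\<^sub>R Y) \<bullet> (X - Y) = 0"
    if "D (\<phi> X) = \<tau> *\<^sub>R L X" "D (\<phi> Y) = \<mu> *\<^sub>R L Y" "\<phi> X \<in> ellipse a b" "\<phi> Y \<in> ellipse a b" for X Y \<tau> \<mu>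
  proof -
    \<comment> \<open>The mixed terms cancel because \<open>D\<close> is self-adjoint.\<close>
    have "(D (\<phi> X) + D (\<phi> Y)) \<bullet> (\<phi> X - \<phi> Y) = \<phi> X \<bullet> D (\<phi> X) - \<phi> Y \<bullet> D (\<phi> Y)"
      by (simp add: D_def inner_prod_def algebra_simps diff_divide_distrib)
    also have "\<dots> = 0" using on[OF that(3)] on[OF that(4)] by simp
    also have "(D (\<phi> X) + D (\<phi> Y)) \<bullet> (\<phi> X - \<phi> Y) = L (\<tau> *\<^sub>R X + \<mu> *\<^sub>R Y) \<bullet> L (X - Y)"
      by (simp add: that diff_\<phi> linear_add[OF linear] linear_cmul[OF linear])
    also have "\<dots> = r\<^sup>2 * ((\<tau> *\<^sub>R X + \<mu> *\<^sub>R Y) \<bullet> (X - Y))" by (rule inner_L)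
    finally show ?thesis using r_pos by simp
  qed
  have "(y + z) * (\<tau>B * y - \<tau>C * z) = 0"
    using chord[OF DB DC] bil by (simp add: B_def C_def inner_prod_def algebra_simps)
  then have BC: "\<tau>B * y = \<tau>C * z" using ynz by simp
  have "y * (1 + z\<^sup>2) * (\<tau>A * (y + z) - \<tau>C * z * m) = m\<^sup>2 * ((\<tau>A *\<^sub>R A + \<tau>C *\<^sub>R C) \<bullet> (A - C))"
    unfolding A_def C_def using mnz
    by (simp add: inner_prod_def divide_simps) (simp add: m_def, algebra)
  also have "\<dots> = 0" using chord[OF DA DC] bil by simp
  finally have AC: "\<tau>A * (y + z) = \<tau>C * z * m" using ynz y2z2_pos by simp
  \<comment> \<open>The common product of multiplier and tangent length, scaled so that all three
    multipliers and the matrix entries of \<open>D\<close> become polynomials times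
    \<kappa>.\<close>
  define \<kappa> where "\<kappa> = \<tau>C * z / (2 * y * z * (y + z))"
  have \<kappa>: "\<tau>C = 2 * y * (y + z) * \<kappa>" "\<tau>B = 2 * z * (y + z) * \<kappa>" "\<tau>A = 2 * y * z * m * \<kappa>"
  proof -
    have k: "2 * y * z * (y + z) * \<kappa> = \<tau>C * z" using ynz by (simp add: \<kappa>_def)
    have "z * \<tau>C = z * (2 * y * (y + z) * \<kappa>)" using k by algebra
    then show "\<tau>C = 2 * y * (y + z) * \<kappa>" using ynz by simp
    have "y * \<tau>B = y * (2 * z * (y + z) * \<kappa>)" using k BC by algebra
    then show "\<tau>B = 2 * z * (y + z) * \<kappa>" using ynz by simp
    have "(y + z) * \<tau>A = (y + z) * (2 * y * z * m * \<kappa>)" using k AC by algebra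
    then show "\<tau>A = 2 * y * z * m * \<kappa>" using ynz by simp
  qed
  let ?e = "L (1, 0)" and ?f = "L (0, 1)"
  have L_eq: "L v = fst v *\<^sub>R ?e + snd v *\<^sub>R ?f" for v
  proof -
    have "v = fst v *\<^sub>R (1, 0) + snd v *\<^sub>R (0, 1)" by (simp add: prod_eq_iff)
    then show ?thesis by (metis linear_add[OF linear] linear_cmul[OF linear])
  qed
  have DL: "D (L (X - Y)) = D (\<phi> X) - D (\<phi> Y)" for X Y
    by (simp add: D_lin flip: diff_\<phi>)
  have "(y + z) *\<^sub>R D ?e = D (\<phi> C) - D (\<phi> B)"
    unfolding DL[symmetric] L_eq[of "C - B"] by (simp add: D_lin C_def B_def add.commute)
  also have "\<dots> = (y + z) *\<^sub>R ((4 * y * z * \<kappa>) *\<^sub>R ?e + (2 * (z - y) * \<kappa>) *\<^sub>R ?f)"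
    unfolding DB DC L_eq[of B] L_eq[of C] \<kappa>
    by (simp add: B_def C_def prod_eq_iff) (intro conjI; algebra)
  finally have De: "D ?e = (4 * y * z * \<kappa>) *\<^sub>R ?e + (2 * (z - y) * \<kappa>) *\<^sub>R ?f" using ynz by simp
  have "(y * (1 - z\<^sup>2) / m) *\<^sub>R D ?e + (2 * y * z / m) *\<^sub>R D ?f = D (\<phi> A) - D (\<phi> C)"
  proof -
    have "A - C = (y * (1 - z\<^sup>2) / m, 2 * y * z / m)"
      unfolding A_def C_def using mnz
      by (simp add: divide_simps) (simp add: m_def power2_eq_square algebra_simps)
    then show ?thesis unfolding DL[symmetric] L_eq[of "A - C"] by (simp add: D_lin)
  qed
  also have "\<dots> = (2 * y * \<kappa> * (z * (y - z) - z * (y + z))) *\<^sub>R ?e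
      + (2 * y * \<kappa> * (z * (y * z + 1) + (y + z))) *\<^sub>R ?f"
  proof -
    have "\<tau>A * fst A = 2 * y * z * \<kappa> * (y - z)" "\<tau>A * snd A = 2 * y * z * \<kappa> * (y * z + 1)"
      unfolding \<kappa> A_def by simp_all
    then have DA': "D (\<phi> A) = (2 * y * z * \<kappa> * (y - z)) *\<^sub>R ?e + (2 * y * z * \<kappa> * (y * z + 1)) *\<^sub>R ?f"
      unfolding DA L_eq[of A] by (simp add: scaleR_add_right)
    show ?thesis
      unfolding DA' DC L_eq[of C] \<kappa> by (simp add: C_def prod_eq_iff) (intro conjI; algebra)
  qed
  finally have "m *\<^sub>R ((y * (1 - z\<^sup>2) / m) *\<^sub>R D ?e + (2 * y * z / m) *\<^sub>R D ?f)
      = m *\<^sub>R ((2 * y * \<kappa> * (z * (y - z) - z * (y + z))) *\<^sub>R ?e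
      + (2 * y * \<kappa> * (z * (y * z + 1) + (y + z))) *\<^sub>R ?f)" by simp
  then have "(y * (1 - z\<^sup>2)) *\<^sub>R D ?e + (2 * y * z) *\<^sub>R D ?f
      = (m * (2 * y * \<kappa> * (z * (y - z) - z * (y + z)))) *\<^sub>R ?e
      + (m * (2 * y * \<kappa> * (z * (y * z + 1) + (y + z)))) *\<^sub>R ?f"
    by (simp add: scaleR_add_right)
  then have "(2 * y * z) *\<^sub>R D ?f
      = (m * (2 * y * \<kappa> * (z * (y - z) - z * (y + z))) - y * (1 - z\<^sup>2) * (4 * y * z * \<kappa>)) *\<^sub>R ?e
      + (m * (2 * y * \<kappa> * (z * (y * z + 1) + (y + z))) - y * (1 - z\<^sup>2) * (2 * (z - y) * \<kappa>)) *\<^sub>R ?f"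
    unfolding De by (simp add: algebra_simps)
  also have "m * (2 * y * \<kappa> * (z * (y - z) - z * (y + z))) - y * (1 - z\<^sup>2) * (4 * y * z * \<kappa>)
      = 2 * y * z * (2 * (z - y) * \<kappa>)"
    unfolding m_def by algebra
  also have "m * (2 * y * \<kappa> * (z * (y * z + 1) + (y + z))) - y * (1 - z\<^sup>2) * (2 * (z - y) * \<kappa>)
      = 2 * y * z * ((W - 4) * \<kappa>)"
    unfolding m_def W_def by algebra
  finally have "(2 * y * z) *\<^sub>R D ?f
      = (2 * y * z) *\<^sub>R ((2 * (z - y) * \<kappa>) *\<^sub>R ?e + ((W - 4) * \<kappa>) *\<^sub>R ?f)"
    by (simp add: scaleR_add_right)
  \<comment> \<open>The off-diagonal entries agree with those in \<open>De\<close>, as they must for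
    a self-adjoint map in an orthogonal basis of vectors of equal length.\<close>
  then have Df: "D ?f = (2 * (z - y) * \<kappa>) *\<^sub>R ?e + ((W - 4) * \<kappa>) *\<^sub>R ?f" using ynz by simp
  \<comment> \<open>Applying \<open>D\<close> to one argument of \<open>det2\<close> at a time and
    adding yields the trace times \<open>det2\<close>; applying it to both yields the determinant.
    This compares the axes of the ellipse with the basis \<open>?e\<close>,
    \<open>?f\<close>.\<close>
  have "(1 / a\<^sup>2 + 1 / b\<^sup>2) * det2 ?e ?f = det2 (D ?e) ?f + det2 ?e (D ?f)"
    by (simp add: det2_def D_def algebra_simps)
  also have "\<dots> = ((W + 4 * m) * \<kappa>) * det2 ?e ?f"
    unfolding De Df m_def det2_def by (simp add: algebra_simps)
  finally have tr: "1 / a\<^sup>2 + 1 / b\<^sup>2 = (W + 4 * m) * \<kappa>" using det2_L by simp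
  have "1 / (a\<^sup>2 * b\<^sup>2) * det2 ?e ?f = det2 (D ?e) (D ?f)"
    by (simp add: det2_def D_def algebra_simps diff_divide_distrib)
  also have "\<dots> = (4 * y * z * (W - 4) - 4 * (z - y)\<^sup>2) * \<kappa>\<^sup>2 * det2 ?e ?f"
    unfolding De Df det2_def by simp algebra
  also have "4 * y * z * (W - 4) - 4 * (z - y)\<^sup>2 = 4 * m * (W + m)"
    unfolding W_def m_def by algebra
  finally have dt: "1 / (a\<^sup>2 * b\<^sup>2) = 4 * m * (W + m) * \<kappa>\<^sup>2"
    by (simp only: mult_right_cancel[OF det2_L])
  \<comment> \<open>\<open>s\<close> is the inverse of the determinant of \<open>D\<close>. Forming
    \<open>trace^2 / det\<close> eliminates the unknown \<kappa>.\<close>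
  define s where "s = a\<^sup>2 * b\<^sup>2"
  have 1: "a\<^sup>2 + b\<^sup>2 = s * ((W + 4 * m) * \<kappa>)"
    unfolding tr[symmetric] s_def using assms by (simp add: field_simps)
  have 2: "1 = s * (4 * m * (W + m) * \<kappa>\<^sup>2)"
    unfolding dt[symmetric] s_def using assms by (simp add: field_simps)
  have "(a\<^sup>2 + b\<^sup>2)\<^sup>2 * (4 * m * (W + m)) = s * (W + 4 * m)\<^sup>2"
    unfolding 1 using 2 by algebra
  then have "m\<^sup>2 * ((a\<^sup>2 + b\<^sup>2)\<^sup>2 * (4 * (W / m + 1))) = m\<^sup>2 * (s * (W / m + 4)\<^sup>2)"
    by (simp add: field_simps power2_eq_square)
  then show ?thesis unfolding s_def by simp
qed

end

section \<open>Invariance over the family of 3-periodics\<close>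

lemma scalene_billiard_invariants:
  assumes "a > 0" "b > 0" "billiard_3_periodic a b A B C" "scalene A B C"
  obtains w where "8 < w" "(a\<^sup>2 + b\<^sup>2)\<^sup>2 * (4 * (w + 1)) = a\<^sup>2 * b\<^sup>2 * (w + 4)\<^sup>2"
    "inradius A B C / circumradius A B C = 4 / w"
    "focal_length (excentral_Jerabek_hyperbola A B C) / focal_length (Feuerbach_hyperbola A B C)
      = sqrt (w / 2)"
proof -
  have "triangle A B C" using assms by (simp add: billiard_3_periodic_def)
  then obtain \<phi> Z L r y z where sim: "similarity \<phi> Z L r" and can: "canonical_triangle y z"
    and ABC: "A = \<phi> (canonical_triangle.A y z)" "B = \<phi> (canonical_triangle.B y)" "C = \<phi> (canonical_triangle.C z)"
    by (rule similar_canonical_triangle)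
  interpret similarity \<phi> Z L r by (rule sim)
  interpret c: canonical_triangle y z by (rule can)
  have "scalene c.A c.B c.C"
    using assms(4) r_pos by (simp add: ABC scalene_def dist_\<phi>)
  then interpret similar_scalene_triangle \<phi> Z L r y z by unfold_locales
  show ?thesis
    using that[OF Euler_inequality] billiard_relation assms radius_ratio focal_length_ratio
    unfolding ABC by blast
qed

text \<open>The function \<open>(w + 4)\<^sup>2 / (w + 1)\<close> increases for
  \<open>w > 2\<close>. Algebraically, a second solution \<open>w\<close> besides \<open>v\<close>
  satisfies \<open>(v + 1) * (w + 1) = 9\<close>, impossible when both exceed
  \<open>8\<close>.\<close>

lemma invariant_unique:
  fixes v w p q :: real
  assumes "8 < v" "8 < w" "p * (4 * (v + 1)) = q * (v + 4)\<^sup>2" "p * (4 * (w + 1)) = q * (w + 4)\<^sup>2" "p \<noteq> 0"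
  shows "v = w"
proof -
  have "q \<noteq> 0" using assms by auto
  moreover have "4 * p * q * ((v - w) * (v * w + v + w - 8)) = 0"
    using assms(3,4) by algebra
  ultimately have "(v - w) * (v * w + v + w - 8) = 0" using assms(5) by simp
  moreover have "0 < v * w" using assms by simp
  then have "v * w + v + w - 8 > 0" using assms by linarith
  ultimately show ?thesis by simp
qed

theorem theorem2:
  fixes a b :: real
  assumes "b > 0" and "a > b"
  shows "\<exists>k. \<forall>A B C. billiard_3_periodic a b A B C \<and> scalene A B C \<longrightarrow>
    (let \<rho> = inradius A B C / circumradius A B C;
         l = focal_length (Feuerbach_hyperbola A B C);
         l' = focal_length (excentral_Jerabek_hyperbola A B C)
     in l' / l = k \<and> l' / l = sqrt (2 / \<rho>) \<and> sqrt (2 / \<rho>) > 2)"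
proof -
  \<comment> \<open>The constant has to be named before any triangle is given, so it is described by
    \<open>a\<close> and \<open>b\<close> alone. That the description has a witness is learned from
    each triangle under consideration.\<close>
  define w where "w = (THE w. 8 < w \<and> (a\<^sup>2 + b\<^sup>2)\<^sup>2 * (4 * (w + 1)) = a\<^sup>2 * b\<^sup>2 * (w + 4)\<^sup>2)"
  have ab: "(a\<^sup>2 + b\<^sup>2)\<^sup>2 \<noteq> 0" using assms by (simp add: sum_power2_eq_zero_iff)
  show ?thesis
  proof (intro exI[of _ "sqrt (w / 2)"] allI impI, elim conjE)
    fix A B C assume "billiard_3_periodic a b A B C" "scalene A B C"
    then obtain v where v: "8 < v" "(a\<^sup>2 + b\<^sup>2)\<^sup>2 * (4 * (v + 1)) = a\<^sup>2 * b\<^sup>2 * (v + 4)\<^sup>2"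
      "inradius A B C / circumradius A B C = 4 / v"
      "focal_length (excentral_Jerabek_hyperbola A B C) / focal_length (Feuerbach_hyperbola A B C)
        = sqrt (v / 2)"
      using assms scalene_billiard_invariants[of a b A B C] by auto
    have "w = v" unfolding w_def
      using v invariant_unique[OF _ _ _ _ ab] by (intro the_equality) auto
    moreover have "2 / (4 / v) = v / 2" by simp
    moreover have "2 < sqrt (v / 2)" using v(1) by (intro real_less_rsqrt) simp
    ultimately show "let \<rho> = inradius A B C / circumradius A B C;
         l = focal_length (Feuerbach_hyperbola A B C);
         l' = focal_length (excentral_Jerabek_hyperbola A B C)
     in l' / l = sqrt (w / 2) \<and> l' / l = sqrt (2 / \<rho>) \<and> sqrt (2 / \<rho>) > 2"
      using v by (simp add: Let_def)
  qed
qed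

end
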